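(* Let $n,d\in\mathbb N=\{1,2,\dots\}$. The identity $(\Sigma+C)_{n,2d}=P_{n,2d}$ holds if and only if $(n,2d)$ is a Hilbert case.
   Context: The Hilbert cases are the pairs $(n,2d)\in\{(2,2d),(n,2),(3,4)\}$, i.e. those with $n=2$, or $2d=2$, or $(n,2d)=(3,4)$. $H_{n,k}$ is the real vector space of forms of degree $k$ in $n$ variables. $P_{n,2d}=\{f\in H_{n,2d}: f(v)\ge0\ \forall v\in\mathbb R^n\}$. $\Sigma_{n,2d}\subseteq H_{n,2d}$ is the set of finite sums of squares of forms in $H_{n,d}$. For $f=\sum_\alpha f_\alpha x^\alpha\in H_{n,2d}$: $\operatorname{supp}(f)=\{\alpha\in\mathbb N_0^n:f_\alpha\neq0\}$, $\operatorname{New}(f)=\operatorname{conv}(\operatorname{supp}(f))$, $V(f)$ is the vertex set of $\operatorname{New}(f)$, $\mathcal S(f)=\{\alpha\in\operatorname{supp}(f):\alpha\in(2\mathbb N_0)^n,\ f_\alpha>0\}$, $\mathcal I(f)=\operatorname{supp}(f)\setminus\mathcal S(f)$. A form $f\in H_{n,2d}$ is a circuit if $\mathcal S(f)=V(f)$, $V(f)$ is affinely independent (single points and the empty set count as affinely independent), and either $\mathcal I(f)=\emptyset$ or $\mathcal I(f)=\{\beta\}$ with $\beta$ in the relative interior of $\operatorname{New}(f)$. It is a nonnegative circuit if moreover $f\in P_{n,2d}$. $C_{n,2d}$ is the set of all finite sums of nonnegative circuits in $H_{n,2d}$. $(\Sigma+C)_{n,2d}=\{g+h: g\in\Sigma_{n,2d},\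 h\in C_{n,2d}\}$.
   Formalization: The pairs with n = 1 and d ≥ 2 are excluded: there every nonnegative form is c x^{2d} with c ≥ 0, a square, so the identity holds although (1,2d) is not a Hilbert case and the claim as stated fails. *)

theory Defs
  imports "HOL-Analysis.Analysis" "HOL-Library.Poly_Mapping"
begin

text \<open>
  Polynomials in n real variables, with n = CARD('n), are finitely supported families of
  coefficients indexed by exponent vectors. Sums and products are those of
  \<^theory>\<open>HOL-Library.Poly_Mapping\<close>; since exponent vectors add componentwise, the product is
  the usual one on the polynomial ring.
\<close>

type_synonym 'n rpoly = "(nat ^ 'n) \<Rightarrow>\<^sub>0 real"

definition poly_eval :: "'n::finite rpoly \<Rightarrow> real ^ 'n \<Rightarrow> real" where
  "poly_eval f v = (\<Sum>\<alpha>\<in>Poly_Mapping.keys f. Poly_Mapping.lookup f \<alpha> * (\<Prod>i\<in>UNIV. (v $ i) ^ (\<alpha> $ i)))"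

definition forms :: "nat \<Rightarrow> 'n::finite rpoly set" where
  "forms k = {f. \<forall>\<alpha>\<in>Poly_Mapping.keys f. (\<Sum>i\<in>UNIV. \<alpha> $ i) = k}"

text \<open>
  The sets of forms of even degree 2d below take d, not 2d, as their argument; the number of
  variables is determined by the type. All finite sums may be empty.
\<close>

definition psd_forms :: "nat \<Rightarrow> 'n::finite rpoly set" where
  "psd_forms d = {f \<in> forms (2 * d). \<forall>v. poly_eval f v \<ge> 0}"

definition sos_forms :: "nat \<Rightarrow> 'n::finite rpoly set" where
  "sos_forms d = {f. \<exists>(m::nat) g. (\<forall>i<m. g i \<in> forms d) \<and> f = (\<Sum>i<m. (g i)\<^sup>2)}"

definition exponent_point :: "nat ^ 'n \<Rightarrow> real ^ 'n::finite" where
  "exponent_point \<alpha> = (\<chi> i. real (\<alpha> $ i))"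

definition newton_polytope :: "'n::finite rpoly \<Rightarrow> (real ^ 'n) set" where
  "newton_polytope f = convex hull (exponent_point ` Poly_Mapping.keys f)"

definition newton_vertices :: "'n::finite rpoly \<Rightarrow> (real ^ 'n) set" where
  "newton_vertices f = {x. x extreme_point_of newton_polytope f}"

definition square_exponents :: "'n::finite rpoly \<Rightarrow> (nat ^ 'n) set" where
  "square_exponents f = {\<alpha> \<in> Poly_Mapping.keys f. (\<forall>i. even (\<alpha> $ i)) \<and> Poly_Mapping.lookup f \<alpha> > 0}"

definition inner_exponents :: "'n::finite rpoly \<Rightarrow> (nat ^ 'n) set" where
  "inner_exponents f = Poly_Mapping.keys f - square_exponents f"

text \<open>The zero form is a circuit: its support and its vertex set are empty.\<close>

definition circuits :: "nat \<Rightarrow> 'n::finite rpoly set" where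
  "circuits d = {f \<in> forms (2 * d).
     exponent_point ` square_exponents f = newton_vertices f \<and>
     \<not> affine_dependent (newton_vertices f) \<and>
     (inner_exponents f = {} \<or>
      (\<exists>\<beta>. inner_exponents f = {\<beta>} \<and> exponent_point \<beta> \<in> rel_interior (newton_polytope f)))}"

definition nonneg_circuits :: "nat \<Rightarrow> 'n::finite rpoly set" where
  "nonneg_circuits d = circuits d \<inter> psd_forms d"

definition sonc_forms :: "nat \<Rightarrow> 'n::finite rpoly set" where
  "sonc_forms d = {f. \<exists>(m::nat) g. (\<forall>i<m. g i \<in> nonneg_circuits d) \<and> f = (\<Sum>i<m. g i)}"

definition sos_plus_sonc_forms :: "nat \<Rightarrow> 'n::finite rpoly set" where
  "sos_plus_sonc_forms d = {g + h | g h. g \<in> sos_forms d \<and> h \<in> sonc_forms d}"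

text \<open>
  The pairs (1, 2d) with d > 1 are not Hilbert cases, although every nonnegative form in one
  variable is a square. A characterization of equality by Hilbert cases must exclude these pairs.
\<close>

definition hilbert_case :: "nat \<Rightarrow> nat \<Rightarrow> bool" where
  "hilbert_case n k \<longleftrightarrow> n = 2 \<or> k = 2 \<or> (n, k) = (3, 4)"

end

theory Submission
  imports Defs
begin

text \<open>
  A circuit vanishing both at \<open>(1, \<dots>, 1)\<close> and at a point with multiplicatively independent positive
  coordinates (we take distinct primes) is zero. Hence a nonnegative form with these two zeros that is
  not a sum of squares is not in the cone of sums of squares and nonnegative circuits. Robinson's
  sextic, times an even power of a variable, and the quartic of Choi and Lam acquire such zeros after a
  linear change of coordinates. They are not sums of squares because a linear relation between point
  evaluations, valid for cubics and quadrics respectively, involves exactly one point where the form is nonzero.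

  Conversely, nonnegative binary forms and quadratic forms are sums of squares by splitting off
  squares. A nonnegative ternary quartic is treated following Choi and Lam: subtracting a multiple of a
  positive sum of squares creates a zero, at which the quartic is quadratic in the first coordinate,
  \<open>x\<^sup>2 f + 2 x g + h\<close> with binary forms \<open>f\<close>, \<open>g\<close>, \<open>h\<close>. Repeating this produces a second zero and then a
  zero of the discriminant, after which completing the square leaves a nonnegative binary form.
\<close>


subsection \<open>Evaluation of forms\<close>

definition monomial_fun :: "nat ^ 'n::finite \<Rightarrow> real ^ 'n \<Rightarrow> real" where
  "monomial_fun \<alpha> v = (\<Prod>i\<in>UNIV. (v $ i) ^ (\<alpha> $ i))"

lemma monomial_fun_0 [simp]: "monomial_fun 0 v = 1"
  by (simp add: monomial_fun_def)

lemma monomial_fun_add: "monomial_fun (\<alpha> + \<beta>) v = monomial_fun \<alpha> v * monomial_fun \<beta> v"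
  by (simp add: monomial_fun_def power_add prod.distrib)

lemma monomial_fun_axis [simp]: "monomial_fun (axis i 1) v = v $ i"
proof -
  have "(v $ j) ^ (axis i 1 $ j) = (if j = i then v $ j else 1)" for j
    by (simp add: axis_def)
  then show ?thesis
    by (simp add: monomial_fun_def)
qed

lemma poly_eval_superset:
  assumes "finite A" "Poly_Mapping.keys f \<subseteq> A"
  shows "poly_eval f v = (\<Sum>\<alpha>\<in>A. Poly_Mapping.lookup f \<alpha> * monomial_fun \<alpha> v)"
  unfolding poly_eval_def monomial_fun_def
  by (rule sum.mono_neutral_left) (use assms in \<open>auto simp: in_keys_iff\<close>)

lemma poly_eval_eq: "poly_eval f v = (\<Sum>\<alpha>\<in>Poly_Mapping.keys f. Poly_Mapping.lookup f \<alpha> * monomial_fun \<alpha> v)"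
  by (rule poly_eval_superset) auto

lemma poly_eval_0 [simp]: "poly_eval 0 v = 0"
  by (simp add: poly_eval_def)

lemma poly_eval_single [simp]: "poly_eval (Poly_Mapping.single \<alpha> c) v = c * monomial_fun \<alpha> v"
  by (subst poly_eval_superset[of "{\<alpha>}"]) auto

lemma poly_eval_add [simp]: "poly_eval (f + g) v = poly_eval f v + poly_eval g v"
proof -
  let ?A = "Poly_Mapping.keys f \<union> Poly_Mapping.keys g"
  have "poly_eval h v = (\<Sum>\<alpha>\<in>?A. Poly_Mapping.lookup h \<alpha> * monomial_fun \<alpha> v)"
    if "Poly_Mapping.keys h \<subseteq> ?A" for h
    using that by (intro poly_eval_superset) auto
  from this[of f] this[of g] this[of "f + g"] show ?thesis
    using keys_add[of f g] by (simp add: lookup_add algebra_simps sum.distrib)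
qed

lemma poly_eval_sum: "poly_eval (\<Sum>i\<in>A. f i) v = (\<Sum>i\<in>A. poly_eval (f i) v)"
  by (induction A rule: infinite_finite_induct) auto

lemma poly_mapping_eq_sum_single:
  "f = (\<Sum>\<alpha>\<in>Poly_Mapping.keys f. Poly_Mapping.single \<alpha> (Poly_Mapping.lookup f \<alpha>))"
  by (rule poly_mapping_eqI) (auto simp: lookup_sum lookup_single when_def in_keys_iff)

lemma poly_eval_mult [simp]: "poly_eval (f * g) v = poly_eval f v * poly_eval g v"
proof -
  let ?s = "\<lambda>f \<alpha>. Poly_Mapping.single \<alpha> (Poly_Mapping.lookup f \<alpha>)"
  have "f * g = (\<Sum>\<alpha>\<in>Poly_Mapping.keys f. ?s f \<alpha>) * (\<Sum>\<beta>\<in>Poly_Mapping.keys g. ?s g \<beta>)"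
    by (simp flip: poly_mapping_eq_sum_single)
  also have "\<dots> = (\<Sum>\<alpha>\<in>Poly_Mapping.keys f. \<Sum>\<beta>\<in>Poly_Mapping.keys g.
      Poly_Mapping.single (\<alpha> + \<beta>) (Poly_Mapping.lookup f \<alpha> * Poly_Mapping.lookup g \<beta>))"
    by (simp add: sum_product mult_single)
  finally show ?thesis
    by (simp add: poly_eval_sum monomial_fun_add poly_eval_eq[of f] poly_eval_eq[of g]
        sum_product mult_ac)
qed

lemma poly_eval_power [simp]: "poly_eval (f ^ k) v = poly_eval f v ^ k"
proof (induction k)
  case 0
  have "poly_eval 1 v = 1"
    using poly_eval_single[of 0 1 v] by (simp del: poly_eval_single)
  then show ?case by simp
qed simp

lemma forms_0 [simp]: "0 \<in> forms k"
  by (simp add: forms_def)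

lemma forms_add: "f \<in> forms k \<Longrightarrow> g \<in> forms k \<Longrightarrow> f + g \<in> forms k"
  using keys_add[of f g] by (auto simp: forms_def)

lemma forms_sum: "(\<And>i. i \<in> A \<Longrightarrow> f i \<in> forms k) \<Longrightarrow> (\<Sum>i\<in>A. f i) \<in> forms k"
  by (induction A rule: infinite_finite_induct) (auto intro: forms_add)

lemma forms_mult: "f \<in> forms k \<Longrightarrow> g \<in> forms l \<Longrightarrow> f * g \<in> forms (k + l)"
  using keys_mult[of f g] by (fastforce simp: forms_def sum.distrib)

lemma forms_power2: "f \<in> forms k \<Longrightarrow> f\<^sup>2 \<in> forms (2 * k)"
  using forms_mult[of f k f k] by (simp add: power2_eq_square mult_2)

lemma forms_single: "(\<Sum>i\<in>UNIV. \<alpha> $ i) = k \<Longrightarrow> Poly_Mapping.single \<alpha> c \<in> forms k"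
  by (simp add: forms_def)


subsection \<open>Injectivity of evaluation\<close>

text \<open>Any family of distinct primes serves; the choice operator fixes one for each type of
  variables. Unique factorization makes its coordinates multiplicatively independent.\<close>

definition prime_point :: "real ^ 'n::finite" where
  "prime_point = (\<chi> i. real ((SOME p. inj p \<and> range p \<subseteq> {q. prime (q::nat)}) i))"

lemma prime_point_primes:
  "\<exists>p :: 'n::finite \<Rightarrow> nat. inj p \<and> (\<forall>i. prime (p i)) \<and>
    (prime_point :: real ^ 'n) = (\<chi> i. real (p i))"
proof -
  obtain T where T: "T \<subseteq> {q. prime (q::nat)}" "finite T" "card T = CARD('n)"
    using infinite_arbitrarily_large[OF primes_infinite] by metis
  then obtain p :: "'n \<Rightarrow> nat" where "bij_betw p UNIV T"
    by (metis finite_same_card_bij finite)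
  then have "\<exists>p::'n \<Rightarrow> nat. inj p \<and> range p \<subseteq> {q. prime q}"
    using T(1) by (auto simp: bij_betw_def)
  from someI_ex[OF this] show ?thesis
    unfolding prime_point_def by blast
qed

lemma prime_point_pos: "(prime_point :: real ^ 'n::finite) $ i > 0"
proof -
  obtain p :: "'n \<Rightarrow> nat" where p: "\<And>i. prime (p i)" "(prime_point :: real ^ 'n) = (\<chi> i. real (p i))"
    using prime_point_primes[where 'n = 'n] by blast
  show ?thesis
    unfolding p(2) using prime_gt_0_nat[OF p(1)] by simp
qed

lemma prime_point_neq: "i \<noteq> j \<Longrightarrow> (prime_point :: real ^ 'n::finite) $ i \<noteq> prime_point $ j"
proof -
  assume ij: "i \<noteq> j"
  obtain p :: "'n \<Rightarrow> nat" where p: "inj p" "(prime_point :: real ^ 'n) = (\<chi> i. real (p i))"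
    using prime_point_primes[where 'n = 'n] by blast
  show ?thesis
    unfolding p(2) using ij p(1) by (simp add: inj_eq)
qed

lemma monomial_fun_prime_point_pos: "monomial_fun \<alpha> (prime_point :: real ^ 'n::finite) > 0"
  by (simp add: monomial_fun_def prod_pos prime_point_pos)

text \<open>Unique factorization: the exponent of variable \<open>i\<close> is the multiplicity of
  the prime \<open>p i\<close> in the value.\<close>

lemma monomial_fun_prime_point_inj:
  assumes "monomial_fun \<alpha> (prime_point :: real ^ 'n::finite) = monomial_fun \<beta> prime_point"
  shows "\<alpha> = \<beta>"
proof -
  obtain p :: "'n \<Rightarrow> nat" where p: "inj p" "\<And>i. prime (p i)"
    "(prime_point :: real ^ 'n) = (\<chi> i. real (p i))"
    using prime_point_primes[where 'n = 'n] by blast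
  have *: "(\<Prod>i\<in>UNIV. p i ^ (\<gamma> $ i)) = (\<Prod>q\<in>range p. q ^ (\<gamma> $ inv p q))" for \<gamma>
    using p(1) by (simp add: prod.reindex)
  have "real (\<Prod>i\<in>UNIV. p i ^ (\<alpha> $ i)) = real (\<Prod>i\<in>UNIV. p i ^ (\<beta> $ i))"
    using assms by (simp add: monomial_fun_def p(3))
  then have eq: "(\<Prod>i\<in>UNIV. p i ^ (\<alpha> $ i)) = (\<Prod>i\<in>UNIV. p i ^ (\<beta> $ i))"
    by (simp only: of_nat_eq_iff)
  have m: "multiplicity (p i) (\<Prod>i\<in>UNIV. p i ^ (\<gamma> $ i)) = \<gamma> $ i" for \<gamma> i
    unfolding * by (subst multiplicity_prod_prime_powers) (use p in auto)
  have "\<alpha> $ i = \<beta> $ i" for i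
    using m[of i \<alpha>] m[of i \<beta>] eq by argo
  then show ?thesis
    by (simp only: vec_eq_iff) simp
qed

lemma poly_eval_one: "poly_eval f 1 = (\<Sum>\<alpha>\<in>Poly_Mapping.keys f. Poly_Mapping.lookup f \<alpha>)"
  by (simp add: poly_eval_def)

text \<open>
  Along the powers of the prime point, the monomials of \<open>f\<close> are geometric sequences with pairwise
  distinct ratios, so that the one with the largest ratio dominates.
\<close>

lemma poly_eval_eq_0_imp:
  assumes "\<And>v. poly_eval (f :: 'n::finite rpoly) v = 0"
  shows "f = 0"
proof (rule ccontr)
  assume "f \<noteq> 0"
  define K where "K = Poly_Mapping.keys f"
  define r where "r \<alpha> = monomial_fun \<alpha> (prime_point :: real ^ 'n)" for \<alpha>
  have K: "finite K" "K \<noteq> {}"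
    using \<open>f \<noteq> 0\<close> by (auto simp: K_def)
  then obtain \<beta> where \<beta>: "\<beta> \<in> K" "\<And>\<alpha>. \<alpha> \<in> K \<Longrightarrow> r \<alpha> \<le> r \<beta>"
    using Max_in[of "r ` K"] Max_ge[of "r ` K"] by fastforce
  have r: "r \<alpha> > 0" for \<alpha>
    by (simp add: r_def monomial_fun_prime_point_pos)
  have "(\<Sum>\<alpha>\<in>K. Poly_Mapping.lookup f \<alpha> * (r \<alpha> / r \<beta>) ^ m) = 0" for m
  proof -
    have "monomial_fun \<alpha> (\<chi> i. (prime_point $ i) ^ m) = r \<alpha> ^ m" for \<alpha> :: "nat ^ 'n"
      by (simp add: monomial_fun_def r_def prod_power_distrib power_mult[symmetric] mult.commute)
    then have "(\<Sum>\<alpha>\<in>K. Poly_Mapping.lookup f \<alpha> * r \<alpha> ^ m) = 0"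
      using assms[of "\<chi> i. (prime_point $ i) ^ m"] by (simp add: poly_eval_eq K_def)
    then show ?thesis
      by (simp add: power_divide flip: sum_divide_distrib)
  qed
  moreover have "(\<lambda>m. \<Sum>\<alpha>\<in>K. Poly_Mapping.lookup f \<alpha> * (r \<alpha> / r \<beta>) ^ m)
      \<longlonglongrightarrow> (\<Sum>\<alpha>\<in>K. if \<alpha> = \<beta> then Poly_Mapping.lookup f \<beta> else 0)"
  proof (rule tendsto_sum)
    fix \<alpha> assume \<alpha>: "\<alpha> \<in> K"
    show "(\<lambda>m. Poly_Mapping.lookup f \<alpha> * (r \<alpha> / r \<beta>) ^ m)
      \<longlonglongrightarrow> (if \<alpha> = \<beta> then Poly_Mapping.lookup f \<beta> else 0)"
    proof (cases "\<alpha> = \<beta>")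
      case True
      then show ?thesis using r[of \<beta>] by simp
    next
      case False
      then have "r \<alpha> < r \<beta>"
        using \<beta>(2)[OF \<alpha>] monomial_fun_prime_point_inj[of \<alpha> \<beta>] by (auto simp: r_def less_le)
      then have "(\<lambda>m. (r \<alpha> / r \<beta>) ^ m) \<longlonglongrightarrow> 0"
        using r[of \<alpha>] r[of \<beta>] by (intro LIMSEQ_power_zero) auto
      then show ?thesis
        using False by (auto intro: tendsto_mult_right_zero)
    qed
  qed
  ultimately have "Poly_Mapping.lookup f \<beta> = 0"
    using K(1) \<beta>(1) by (simp add: LIMSEQ_const_iff)
  then show False
    using \<beta>(1) by (simp add: K_def in_keys_iff)
qed

text \<open>Makes the passage from forms to functions reversible, so that identities between forms
  can be checked pointwise.\<close>

lemma poly_eval_inject: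
  assumes "\<And>v. poly_eval f v = poly_eval g v"
  shows "f = (g :: 'n::finite rpoly)"
proof -
  have "poly_eval (f + Poly_Mapping.single 0 (-1) * g) v = 0" for v
    using assms[of v] by simp
  then have "f + Poly_Mapping.single 0 (-1) * g = 0"
    by (rule poly_eval_eq_0_imp)
  then show ?thesis
    by (simp add: single_uminus)
qed


subsection \<open>Homogeneous polynomial functions\<close>

text \<open>With functions in place of coefficient families, a linear change of variables is plain
  composition. The zero function has every degree.\<close>

definition form_fun :: "nat \<Rightarrow> (real ^ 'n::finite \<Rightarrow> real) \<Rightarrow> bool" where
  "form_fun k F \<longleftrightarrow> (\<exists>f\<in>forms k. F = poly_eval f)"

lemma form_fun_poly_eval: "f \<in> forms k \<Longrightarrow> form_fun k (poly_eval f)"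
  by (auto simp: form_fun_def)

lemma form_fun_const: "form_fun 0 (\<lambda>_. c)"
  unfolding form_fun_def
  by (rule bexI[where x = "Poly_Mapping.single 0 c"]) (auto intro: forms_single)

lemma form_fun_zero: "form_fun k (\<lambda>_. 0)"
  unfolding form_fun_def by (rule bexI[where x = 0]) auto

lemma form_fun_component: "form_fun 1 (\<lambda>v. v $ i)"
  unfolding form_fun_def
proof (rule bexI)
  show "(\<lambda>v. v $ i) = poly_eval (Poly_Mapping.single (axis i 1) 1)"
    by (simp add: fun_eq_iff del: One_nat_def)
qed (simp add: forms_single axis_def)

lemma form_fun_add: "form_fun k F \<Longrightarrow> form_fun k G \<Longrightarrow> form_fun k (\<lambda>v. F v + G v)"
  unfolding form_fun_def
  by (clarsimp, rule_tac x = "f + fa" in bexI) (auto intro: forms_add)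

lemma form_fun_mult: "form_fun k F \<Longrightarrow> form_fun l G \<Longrightarrow> form_fun (k + l) (\<lambda>v. F v * G v)"
  unfolding form_fun_def
  by (clarsimp, rule_tac x = "f * fa" in bexI) (auto intro: forms_mult)

lemma form_fun_cmult: "form_fun k F \<Longrightarrow> form_fun k (\<lambda>v. c * F v)"
  using form_fun_mult[OF form_fun_const, of k F c] by simp

lemma form_fun_diff: "form_fun k F \<Longrightarrow> form_fun k G \<Longrightarrow> form_fun k (\<lambda>v. F v - G v)"
  using form_fun_add[of k F "\<lambda>v. -1 * G v"] form_fun_cmult[of k G "-1"] by simp

lemma form_fun_sum:
  "(\<And>i. i \<in> A \<Longrightarrow> form_fun k (F i)) \<Longrightarrow> form_fun k (\<lambda>v. \<Sum>i\<in>A. F i v)"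
  by (induction A rule: infinite_finite_induct) (auto intro: form_fun_zero form_fun_add)

lemma form_fun_power: "form_fun k F \<Longrightarrow> form_fun (m * k) (\<lambda>v. F v ^ m)"
  by (induction m) (auto intro: form_fun_const form_fun_mult)

lemma form_fun_prod:
  "finite A \<Longrightarrow> (\<And>i. i \<in> A \<Longrightarrow> form_fun (k i) (F i)) \<Longrightarrow> form_fun (\<Sum>i\<in>A. k i) (\<lambda>v. \<Prod>i\<in>A. F i v)"
  by (induction A rule: finite_induct) (auto intro: form_fun_const form_fun_mult)

lemma form_fun_power2: "form_fun k F \<Longrightarrow> form_fun (2 * k) (\<lambda>v. (F v)\<^sup>2)"
  using form_fun_power[of k F 2] by simp

lemma form_fun_monomials:
  assumes "form_fun k F"
  obtains A c where "finite A" "\<And>\<alpha>. \<alpha> \<in> A \<Longrightarrow> (\<Sum>i\<in>UNIV. \<alpha> $ i) = k"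
    "\<And>v. F v = (\<Sum>\<alpha>\<in>A. c \<alpha> * monomial_fun \<alpha> v)"
proof -
  obtain f where f: "f \<in> forms k" "F = poly_eval f"
    using assms by (auto simp: form_fun_def)
  show ?thesis
    by (rule that[of "Poly_Mapping.keys f" "Poly_Mapping.lookup f"])
      (use f in \<open>auto simp: forms_def poly_eval_eq\<close>)
qed

lemma form_fun_compose:
  fixes F :: "real ^ 'n::finite \<Rightarrow> real" and L :: "real ^ 'm::finite \<Rightarrow> real ^ 'n"
  assumes "form_fun k F" "\<And>i. form_fun l (\<lambda>v. L v $ i)"
  shows "form_fun (k * l) (\<lambda>v. F (L v))"
proof -
  obtain A c where A: "finite A" "\<And>\<alpha>. \<alpha> \<in> A \<Longrightarrow> (\<Sum>i\<in>UNIV. \<alpha> $ i) = k"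
    "\<And>v. F v = (\<Sum>\<alpha>\<in>A. c \<alpha> * monomial_fun \<alpha> v)"
    using form_fun_monomials[OF assms(1)] by blast
  have "form_fun (k * l) (\<lambda>v. c \<alpha> * monomial_fun \<alpha> (L v))" if "\<alpha> \<in> A" for \<alpha>
  proof -
    have "form_fun (\<Sum>i\<in>UNIV. \<alpha> $ i * l) (\<lambda>v. \<Prod>i\<in>UNIV. (L v $ i) ^ (\<alpha> $ i))"
      by (intro form_fun_prod form_fun_power assms) auto
    then show ?thesis
      using A(2)[OF that] by (auto simp: monomial_fun_def intro!: form_fun_cmult simp flip: sum_distrib_right)
  qed
  then show ?thesis
    unfolding A(3) by (rule form_fun_sum)
qed

lemma form_fun_linear:
  fixes L :: "real ^ 'n::finite \<Rightarrow> real"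
  assumes "linear L"
  shows "form_fun 1 L"
proof -
  have "L v = (\<Sum>i\<in>UNIV. L (axis i 1) * v $ i)" for v
  proof -
    have "L v = L (\<Sum>i\<in>UNIV. v $ i *\<^sub>R axis i 1)"
      by (simp add: basis_expansion flip: scalar_mult_eq_scaleR)
    also have "\<dots> = (\<Sum>i\<in>UNIV. L (axis i 1) * v $ i)"
      using assms by (simp add: linear_sum linear_cmul mult.commute)
    finally show ?thesis .
  qed
  then have "L = (\<lambda>v. \<Sum>i\<in>UNIV. L (axis i 1) * v $ i)"
    by blast
  moreover have "form_fun 1 (\<lambda>v. \<Sum>i\<in>UNIV. L (axis i 1) * v $ i)"
    by (intro form_fun_sum form_fun_cmult form_fun_component)
  ultimately show ?thesis by simp
qed

lemma form_fun_linear_compose: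
  fixes L :: "real ^ 'm::finite \<Rightarrow> real ^ 'n::finite"
  assumes "form_fun k F" "linear L"
  shows "form_fun k (\<lambda>v. F (L v))"
proof -
  have "linear (\<lambda>v. L v $ i)" for i
    using linear_compose[OF assms(2) bounded_linear.linear[OF bounded_linear_vec_nth]]
    by (simp add: o_def)
  then show ?thesis
    using form_fun_compose[OF assms(1) form_fun_linear, of L] by simp
qed

lemma form_fun_cong: "form_fun k F \<Longrightarrow> k = l \<Longrightarrow> (\<And>v. F v = G v) \<Longrightarrow> form_fun l G"
  by (metis ext)

section \<open>Homogeneity and continuity\<close>

lemma form_fun_scaleR:
  assumes "form_fun k F"
  shows "F (t *\<^sub>R v) = t ^ k * F v"
proof -
  obtain A c where A: "finite A" "\<And>\<alpha>. \<alpha> \<in> A \<Longrightarrow> (\<Sum>i\<in>UNIV. \<alpha> $ i) = k"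
    "\<And>v. F v = (\<Sum>\<alpha>\<in>A. c \<alpha> * monomial_fun \<alpha> v)"
    using form_fun_monomials[OF assms(1)] by blast
  have "c \<alpha> * monomial_fun \<alpha> (t *\<^sub>R v) = t ^ k * (c \<alpha> * monomial_fun \<alpha> v)" if "\<alpha> \<in> A" for \<alpha>
    using A(2)[OF that]
    by (simp add: monomial_fun_def power_mult_distrib prod.distrib mult_ac flip: power_sum)
  then show ?thesis
    unfolding A(3) sum_distrib_left by (intro sum.cong) auto
qed

lemma form_fun_at_0: "form_fun k F \<Longrightarrow> k > 0 \<Longrightarrow> F 0 = 0"
  using form_fun_scaleR[of k F 0 0] by (simp add: zero_power)

lemma form_fun_degree_0: "form_fun 0 F \<Longrightarrow> F v = F 0"
  using form_fun_scaleR[of 0 F 0 v] by simp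

lemma form_fun_continuous:
  assumes "form_fun k F"
  shows "continuous_on S F"
proof -
  obtain A c where A: "F = (\<lambda>v. (\<Sum>\<alpha>\<in>A. c \<alpha> * monomial_fun \<alpha> v))"
    using form_fun_monomials[OF assms(1)] by (metis ext)
  show ?thesis
    unfolding A monomial_fun_def by (intro continuous_intros)
qed

section \<open>Divisibility by powers of a coordinate\<close>

text \<open>A point of the hyperplane is a limit of points off it along axis \<open>i\<close>, and
  continuity carries the sign over. Serves to cancel even powers of \<open>v $ i\<close> from
  inequalities.\<close>

lemma nonneg_off_hyperplane:
  fixes F :: "real ^ 'n::finite \<Rightarrow> real"
  assumes "continuous_on UNIV F" "\<And>v. v $ i \<noteq> 0 \<Longrightarrow> F v \<ge> 0"
  shows "F v \<ge> 0"
proof (cases "v $ i = 0")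
  case True
  have "((\<lambda>t::real. F (v + t *\<^sub>R axis i 1)) \<longlongrightarrow> F (v + 0 *\<^sub>R axis i 1)) (at 0)"
    by (rule continuous_on_tendsto_compose[OF assms(1)]) (auto intro!: tendsto_eq_intros)
  moreover have "\<forall>\<^sub>F t::real in at 0. F (v + t *\<^sub>R axis i 1) \<ge> 0"
    using True by (auto simp: eventually_at_filter axis_def intro!: assms(2) always_eventually)
  ultimately show ?thesis
    using tendsto_lowerbound[of _ _ "at (0::real)" 0] by simp
qed (use assms(2) in auto)

text \<open>The monomials that contain variable \<open>i\<close> supply \<open>G\<close>. The others
  do not see coordinate \<open>i\<close>, so their sum is a value of \<open>F\<close> on the
  hyperplane, which is 0.\<close>

lemma form_fun_factor:
  fixes F :: "real ^ 'n::finite \<Rightarrow> real"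
  assumes "form_fun (Suc k) F" "\<And>v. v $ i = 0 \<Longrightarrow> F v = 0"
  obtains G where "form_fun k G" "\<And>v. F v = v $ i * G v"
proof -
  obtain A c where A: "finite A" "\<And>\<alpha>. \<alpha> \<in> A \<Longrightarrow> (\<Sum>i\<in>UNIV. \<alpha> $ i) = Suc k"
    "\<And>v. F v = (\<Sum>\<alpha>\<in>A. c \<alpha> * monomial_fun \<alpha> v)"
    using form_fun_monomials[OF assms(1)] by blast
  let ?B = "{\<alpha>\<in>A. \<alpha> $ i > 0}"
  define G where "G v = (\<Sum>\<alpha>\<in>?B. c \<alpha> * monomial_fun (\<alpha> - axis i 1) v)" for v
  \<comment> \<open>Subtraction of natural numbers is exact here because the exponent of variable
    \<open>i\<close> is positive.\<close>
  have split: "\<alpha> = axis i 1 + (\<alpha> - axis i 1)" if "\<alpha> $ i > 0" for \<alpha> :: "nat ^ 'n"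
    using that by (auto simp: vec_eq_iff axis_def)
  have mon: "monomial_fun \<alpha> v = v $ i * monomial_fun (\<alpha> - axis i 1) v" if "\<alpha> $ i > 0" for \<alpha> v
    by (subst split[OF that]) (simp only: monomial_fun_add monomial_fun_axis)
  have "form_fun k G"
    unfolding G_def
  proof (rule form_fun_sum)
    fix \<alpha> assume "\<alpha> \<in> ?B"
    then have "\<alpha> \<in> A" "\<alpha> $ i > 0" by auto
    have "Suc k = (\<Sum>j\<in>UNIV. (axis i 1 + (\<alpha> - axis i 1)) $ j)"
      using A(2)[OF \<open>\<alpha> \<in> A\<close>] split[OF \<open>\<alpha> $ i > 0\<close>] by simp
    also have "\<dots> = (\<Sum>j\<in>UNIV. (axis i 1 :: nat ^ 'n) $ j) + (\<Sum>j\<in>UNIV. (\<alpha> - axis i 1) $ j)"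
      by (simp only: vector_add_component sum.distrib)
    finally have "(\<Sum>j\<in>UNIV. (\<alpha> - axis i 1) $ j) = k"
      by (simp add: axis_def)
    then have "form_fun k (poly_eval (Poly_Mapping.single (\<alpha> - axis i 1) (c \<alpha>)))"
      by (intro form_fun_poly_eval forms_single)
    then show "form_fun k (\<lambda>v. c \<alpha> * monomial_fun (\<alpha> - axis i 1) v)"
      by (rule form_fun_cong) auto
  qed
  moreover have "F v = v $ i * G v" for v
  proof -
    define v' where "v' = (\<chi> j. if j = i then 0 else v $ j)"
    have v': "monomial_fun \<alpha> v = monomial_fun \<alpha> v'" if "\<alpha> $ i = 0" for \<alpha>
      unfolding monomial_fun_def v'_def by (rule prod.cong) (use that in auto)
    have "v' $ i = 0" by (simp add: v'_def)
    have F: "F u = (\<Sum>\<alpha>\<in>A - ?B. c \<alpha> * monomial_fun \<alpha> u) + u $ i * G u" for u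
    proof -
      have "F u = (\<Sum>\<alpha>\<in>A - ?B. c \<alpha> * monomial_fun \<alpha> u) + (\<Sum>\<alpha>\<in>?B. c \<alpha> * monomial_fun \<alpha> u)"
        unfolding A(3) by (rule sum.subset_diff) (use A(1) in auto)
      moreover have "(\<Sum>\<alpha>\<in>?B. c \<alpha> * monomial_fun \<alpha> u) = u $ i * G u"
        unfolding G_def sum_distrib_left by (rule sum.cong) (auto simp: mon)
      ultimately show ?thesis by simp
    qed
    have "(\<Sum>\<alpha>\<in>A - ?B. c \<alpha> * monomial_fun \<alpha> v) = (\<Sum>\<alpha>\<in>A - ?B. c \<alpha> * monomial_fun \<alpha> v')"
      by (rule sum.cong) (auto simp: v')
    then show ?thesis
      using F[of v] F[of v'] assms(2)[OF \<open>v' $ i = 0\<close>] \<open>v' $ i = 0\<close> by simp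
  qed
  ultimately show ?thesis by (rule that)
qed

text \<open>A nonnegative form does not change sign across the hyperplane, so the cofactor of the
  first division vanishes there too and a second division is possible.\<close>

lemma form_fun_psd_factor:
  fixes F :: "real ^ 'n::finite \<Rightarrow> real"
  assumes "form_fun (Suc (Suc k)) F" "\<And>v. F v \<ge> 0" "\<And>v. v $ i = 0 \<Longrightarrow> F v = 0"
  obtains G where "form_fun k G" "\<And>v. F v = (v $ i)\<^sup>2 * G v" "\<And>v. G v \<ge> 0"
proof -
  obtain H where H: "form_fun (Suc k) H" "\<And>v. F v = v $ i * H v"
    using form_fun_factor[OF assms(1,3)] by metis
  have sgn: "v $ i * H v \<ge> 0" for v
    using H(2) assms(2) by metis
  have "H v = 0" if "v $ i = 0" for v
  proof -
    \<comment> \<open>\<open>S\<close> stays free so that the limit can be taken from either side;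
      the two one-sided limits give opposite signs.\<close>
    have lim: "((\<lambda>t::real. H (v + t *\<^sub>R axis i 1)) \<longlongrightarrow> H v) (at 0 within S)" for S
    proof -
      have "((\<lambda>t::real. H (v + t *\<^sub>R axis i 1)) \<longlongrightarrow> H (v + 0 *\<^sub>R axis i 1)) (at 0 within S)"
        by (rule continuous_on_tendsto_compose[OF form_fun_continuous[OF H(1), of UNIV]])
          (auto intro!: tendsto_eq_intros)
      then show ?thesis by simp
    qed
    have s: "t * H (v + t *\<^sub>R axis i 1) \<ge> 0" for t
      using sgn[of "v + t *\<^sub>R axis i 1"] that by (simp add: axis_def)
    have pos: "H (v + t *\<^sub>R axis i 1) \<ge> 0" if "t > 0" for t
      using s[of t] that by (simp add: zero_le_mult_iff)
    have neg: "H (v + t *\<^sub>R axis i 1) \<le> 0" if "t < 0" for t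
      using s[of t] that by (simp add: zero_le_mult_iff)
    have "H v \<ge> 0"
      by (rule tendsto_lowerbound[OF lim[of "{0<..}"]])
        (auto simp: eventually_at_filter pos intro!: always_eventually)
    moreover have "H v \<le> 0"
      by (rule tendsto_upperbound[OF lim[of "{..<0}"]])
        (auto simp: eventually_at_filter neg intro!: always_eventually)
    ultimately show ?thesis by simp
  qed
  from form_fun_factor[OF H(1) this] obtain G where G: "form_fun k G" "\<And>v. H v = v $ i * G v"
    by metis
  have FG: "F v = (v $ i)\<^sup>2 * G v" for v
    by (simp add: H(2) G(2) power2_eq_square)
  have "G v \<ge> 0" if "v $ i \<noteq> 0" for v
    using assms(2)[of v] that by (simp add: FG zero_le_mult_iff)
  then have "G v \<ge> 0" for v
    by (rule nonneg_off_hyperplane[OF form_fun_continuous[OF G(1)]])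
  with FG G(1) show ?thesis by (intro that)
qed

text \<open>Serves to divide each root in a sum of squares by a power of \<open>v $ i\<close> whose
  square divides the sum. Each division removes the square of \<open>v $ i\<close> from both sides
  of the bound, and continuity extends the reduced bound across the hyperplane.\<close>

lemma form_fun_power_factor:
  fixes G C :: "real ^ 'n::finite \<Rightarrow> real"
  assumes "form_fun (m + k) G" "continuous_on UNIV C" "\<And>v. (G v)\<^sup>2 \<le> (v $ i) ^ (2 * k) * C v"
  shows "\<exists>H. form_fun m H \<and> (\<forall>v. G v = (v $ i) ^ k * H v)"
  using assms(1,3)
proof (induction k arbitrary: G)
  case (Suc k)
  have "G v = 0" if "v $ i = 0" for v
    using Suc.prems(2)[of v] that by simp
  with Suc.prems(1) obtain H where H: "form_fun (m + k) H" "\<And>v. G v = v $ i * H v"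
    using form_fun_factor[of "m + k" G i] by auto
  have "(v $ i) ^ (2 * k) * C v - (H v)\<^sup>2 \<ge> 0" if "v $ i \<noteq> 0" for v
  proof -
    have "(v $ i)\<^sup>2 * (H v)\<^sup>2 \<le> (v $ i)\<^sup>2 * ((v $ i) ^ (2 * k) * C v)"
      using Suc.prems(2)[of v] by (simp add: H(2) power_mult_distrib power2_eq_square mult_ac)
    then show ?thesis
      using that by simp
  qed
  moreover have "continuous_on UNIV (\<lambda>v. (v $ i) ^ (2 * k) * C v - (H v)\<^sup>2)"
    by (intro continuous_intros assms(2) form_fun_continuous[OF H(1)])
  ultimately have "(v $ i) ^ (2 * k) * C v - (H v)\<^sup>2 \<ge> 0" for v
    using nonneg_off_hyperplane[of "\<lambda>v. (v $ i) ^ (2 * k) * C v - (H v)\<^sup>2" i v] by blast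
  then obtain H' where "form_fun m H'" "\<And>v. H v = (v $ i) ^ k * H' v"
    using Suc.IH[OF H(1)] by fastforce
  then show ?case
    using H(2) by (intro exI[of _ H']) simp
qed auto

text \<open>
  Subtracting the multiple of a positive form \<open>H\<close> by the minimal value of \<open>F / H\<close> on the sphere
  creates a zero.
\<close>

lemma form_fun_min:
  fixes F H :: "real ^ 'n::finite \<Rightarrow> real"
  assumes "form_fun k F" "form_fun k H" "\<And>v. v \<noteq> 0 \<Longrightarrow> H v > 0"
  obtains u where "norm u = 1" "\<And>v. F v - F u / H u * H v \<ge> 0"
proof -
  have "H v \<noteq> 0" if "norm v = 1" for v
    using assms(3)[of v] that by force
  then have "continuous_on (sphere 0 1) (\<lambda>v. F v / H v)"
    by (intro continuous_intros form_fun_continuous[OF assms(1)] form_fun_continuous[OF assms(2)]) auto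
  then obtain u where u: "norm u = 1" "\<And>v. norm v = 1 \<Longrightarrow> F u / H u \<le> F v / H v"
    using continuous_attains_inf[of "sphere 0 1" "\<lambda>v. F v / H v"] by auto
  have *: "F v - F u / H u * H v \<ge> 0" if "norm v = 1" for v
  proof -
    have "H v > 0" using assms(3)[of v] that by force
    then show ?thesis using u(2)[OF that] by (simp add: field_simps)
  qed
  \<comment> \<open>Homogeneity reduces the claim to the sphere. At \<open>v = 0\<close> any unit
    vector can serve as direction, and \<open>u\<close> is at hand.\<close>
  have "F v - F u / H u * H v \<ge> 0" for v
  proof -
    obtain w where w: "norm w = 1" "v = norm v *\<^sub>R w"
    proof (cases "v = 0")
      case True
      then show ?thesis using that[of u] u(1) by simp
    next
      case False
      then show ?thesis using that[of "v /\<^sub>R norm v"] by simp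
    qed
    have "F v - F u / H u * H v = norm v ^ k * (F w - F u / H u * H w)"
      by (subst (1 2) w(2)) (simp add: form_fun_scaleR[OF assms(1)] form_fun_scaleR[OF assms(2)] algebra_simps)
    then show ?thesis using *[OF w(1)] by simp
  qed
  with u(1) show ?thesis by (rule that)
qed

lemma form_fun_norm_power: "form_fun (2 * d) (\<lambda>v :: real ^ 'n::finite. (v \<bullet> v) ^ d)"
proof -
  have "form_fun 2 (\<lambda>v :: real ^ 'n. \<Sum>i\<in>UNIV. (v $ i)\<^sup>2)"
    using form_fun_power2[OF form_fun_component] by (intro form_fun_sum) simp
  then have "form_fun 2 (\<lambda>v :: real ^ 'n. v \<bullet> v)"
    by (simp add: inner_vec_def power2_eq_square)
  from form_fun_power[OF this, of d] show ?thesis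
    by (simp add: mult.commute)
qed

section \<open>Expansions of quadratic and cubic forms\<close>

text \<open>Each monomial of positive degree is charged to one variable \<open>s \<alpha>\<close>
  that it contains; grouping by this variable gives the \<open>G i\<close>. Iteration expands
  quadrics and cubics.\<close>

lemma form_fun_split_var:
  fixes F :: "real ^ 'n::finite \<Rightarrow> real"
  assumes "form_fun (Suc k) F"
  obtains G where "\<And>i. form_fun k (G i)" "\<And>v. F v = (\<Sum>i\<in>UNIV. v $ i * G i v)"
proof -
  obtain A c where A: "finite A" "\<And>\<alpha>. \<alpha> \<in> A \<Longrightarrow> (\<Sum>i\<in>UNIV. \<alpha> $ i) = Suc k"
    "\<And>v. F v = (\<Sum>\<alpha>\<in>A. c \<alpha> * monomial_fun \<alpha> v)"
    using form_fun_monomials[OF assms(1)] by blast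
  define s where "s \<alpha> = (SOME i. \<alpha> $ i > 0)" for \<alpha> :: "nat ^ 'n"
  have s: "\<alpha> $ s \<alpha> > 0" if "\<alpha> \<in> A" for \<alpha>
  proof -
    have "\<exists>i. \<alpha> $ i > 0"
      using A(2)[OF that] by (metis Zero_not_Suc neq0_conv sum.neutral)
    then show ?thesis unfolding s_def by (rule someI_ex)
  qed
  have "\<exists>H. form_fun k H \<and> (\<forall>v. c \<alpha> * monomial_fun \<alpha> v = v $ s \<alpha> * H v)" if "\<alpha> \<in> A" for \<alpha>
  proof -
    have "form_fun (Suc k) (\<lambda>v. c \<alpha> * monomial_fun \<alpha> v)"
      using form_fun_poly_eval[OF forms_single[OF A(2)[OF that]], of "c \<alpha>"] by (rule form_fun_cong) auto
    moreover have "c \<alpha> * monomial_fun \<alpha> v = 0" if "v $ s \<alpha> = 0" for v :: "real ^ 'n"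
      using that s[OF \<open>\<alpha> \<in> A\<close>] by (auto simp: monomial_fun_def)
    ultimately show ?thesis
      by (rule form_fun_factor) auto
  qed
  then obtain H where H: "\<And>\<alpha>. \<alpha> \<in> A \<Longrightarrow> form_fun k (H \<alpha>)"
    "\<And>\<alpha> v. \<alpha> \<in> A \<Longrightarrow> c \<alpha> * monomial_fun \<alpha> v = v $ s \<alpha> * H \<alpha> v"
    by metis
  show ?thesis
  proof (rule that)
    show "form_fun k (\<lambda>v. \<Sum>\<alpha>\<in>{\<alpha>\<in>A. s \<alpha> = i}. H \<alpha> v)" for i
      by (intro form_fun_sum) (auto simp: H)
    fix v :: "real ^ 'n"
    have "F v = (\<Sum>\<alpha>\<in>A. v $ s \<alpha> * H \<alpha> v)"
      unfolding A(3) by (intro sum.cong H(2)) auto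
    also have "\<dots> = (\<Sum>i\<in>UNIV. \<Sum>\<alpha>\<in>{\<alpha>\<in>A. s \<alpha> = i}. v $ s \<alpha> * H \<alpha> v)"
      by (rule sum.group[symmetric]) (use A(1) in auto)
    also have "\<dots> = (\<Sum>i\<in>UNIV. v $ i * (\<Sum>\<alpha>\<in>{\<alpha>\<in>A. s \<alpha> = i}. H \<alpha> v))"
      by (simp add: sum_distrib_left)
    finally show "F v = (\<Sum>i\<in>UNIV. v $ i * (\<Sum>\<alpha>\<in>{\<alpha>\<in>A. s \<alpha> = i}. H \<alpha> v))" .
  qed
qed

lemma quadratic_form_fun:
  fixes F :: "real ^ 'n::finite \<Rightarrow> real"
  assumes "form_fun 2 F"
  obtains a where "\<And>v. F v = (\<Sum>i\<in>UNIV. \<Sum>j\<in>UNIV. a i j * (v $ i * v $ j))"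
proof -
  obtain G where G: "\<And>i. form_fun 1 (G i)" "\<And>v. F v = (\<Sum>i\<in>UNIV. v $ i * G i v)"
    using form_fun_split_var[of 1 F] assms by (auto simp: numeral_2_eq_2)
  have "\<exists>H. (\<forall>j. form_fun 0 (H j)) \<and> (\<forall>v. G i v = (\<Sum>j\<in>UNIV. v $ j * H j v))" for i
    using form_fun_split_var[of 0 "G i"] G(1)[of i] by (metis One_nat_def)
  then obtain H where H: "\<And>i j. form_fun 0 (H i j)" "\<And>i v. G i v = (\<Sum>j\<in>UNIV. v $ j * H i j v)"
    by metis
  define a where "a i j = H i j 0" for i j
  have a: "H i j v = a i j" for i j v
    unfolding a_def by (rule form_fun_degree_0[OF H(1)])
  show ?thesis
    by (rule that[of a]) (simp add: G(2) H(2) a sum_distrib_left mult_ac)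
qed

lemma cubic_form_fun:
  fixes F :: "real ^ 'n::finite \<Rightarrow> real"
  assumes "form_fun 3 F"
  obtains a where "\<And>v. F v = (\<Sum>i\<in>UNIV. \<Sum>j\<in>UNIV. \<Sum>k\<in>UNIV. a i j k * (v $ i * v $ j * v $ k))"
proof -
  obtain G where G: "\<And>i. form_fun 2 (G i)" "\<And>v. F v = (\<Sum>i\<in>UNIV. v $ i * G i v)"
    using form_fun_split_var[of 2 F] assms by (auto simp: numeral_3_eq_3 numeral_2_eq_2)
  have "\<exists>a. \<forall>v. G i v = (\<Sum>j\<in>UNIV. \<Sum>k\<in>UNIV. a j k * (v $ j * v $ k))" for i
  proof -
    obtain a where "\<And>v. G i v = (\<Sum>j\<in>UNIV. \<Sum>k\<in>UNIV. a j k * (v $ j * v $ k))"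
      using quadratic_form_fun[OF G(1)[of i]] by blast
    then show ?thesis by blast
  qed
  then obtain a where "\<forall>i v. G i v = (\<Sum>j\<in>UNIV. \<Sum>k\<in>UNIV. a i j k * (v $ j * v $ k))"
    using choice[of "\<lambda>i a. \<forall>v. G i v = (\<Sum>j\<in>UNIV. \<Sum>k\<in>UNIV. a j k * (v $ j * v $ k))"] by blast
  then show ?thesis
    by (intro that[of a]) (simp add: G(2) sum_distrib_left mult_ac)
qed

text \<open>It suffices to check products of two coordinates. This is the relation between point
  evaluations that is used against the quartic of Choi and Lam.\<close>

lemma form_fun_parallelogram:
  assumes "form_fun 2 F"
  shows "F (u + v) + F (u - v) = 2 * F u + 2 * F v"
proof -
  obtain a where a: "\<And>v. F v = (\<Sum>i\<in>UNIV. \<Sum>j\<in>UNIV. a i j * (v $ i * v $ j))"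
    using quadratic_form_fun[OF assms] by blast
  show ?thesis
    unfolding a sum_distrib_left sum.distrib[symmetric]
    by (intro sum.cong refl) (simp add: algebra_simps)
qed

text \<open>The fourth-order difference in two directions, which annihilates cubic polynomials.\<close>

lemma form_fun_nine_points:
  assumes "form_fun 3 F"
  shows "F (w + u + v) + F (w + u - v) + F (w - u + v) + F (w - u - v) + 4 * F w
    = 2 * F (w + u) + 2 * F (w - u) + 2 * F (w + v) + 2 * F (w - v)"
proof -
  obtain a where a: "\<And>v. F v = (\<Sum>i\<in>UNIV. \<Sum>j\<in>UNIV. \<Sum>k\<in>UNIV. a i j k * (v $ i * v $ j * v $ k))"
    using cubic_form_fun[OF assms] by blast
  show ?thesis
    unfolding a sum_distrib_left sum.distrib[symmetric]
    by (intro sum.cong refl) (simp add: algebra_simps)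
qed


subsection \<open>Sums of squares\<close>

text \<open>Adding one square at a time, rather than indexing a finite family, lets closure
  properties go by rule induction.\<close>

inductive sos_fun :: "nat \<Rightarrow> (real ^ 'n::finite \<Rightarrow> real) \<Rightarrow> bool" for d where
  sos_fun_zero: "sos_fun d (\<lambda>v. 0)"
| sos_fun_add_power2: "sos_fun d F \<Longrightarrow> form_fun d g \<Longrightarrow> sos_fun d (\<lambda>v. F v + (g v)\<^sup>2)"

lemma sos_fun_cong: "sos_fun d F \<Longrightarrow> (\<And>v. G v = F v) \<Longrightarrow> sos_fun d G"
  by (metis ext)

lemma sos_fun_power2: "form_fun d g \<Longrightarrow> sos_fun d (\<lambda>v. (g v)\<^sup>2)"
  using sos_fun_add_power2[OF sos_fun_zero] by simp

lemma sos_fun_add: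
  assumes "sos_fun d F" "sos_fun d G"
  shows "sos_fun d (\<lambda>v. F v + G v)"
  using assms(2)
proof induction
  case sos_fun_zero
  then show ?case using assms(1) by simp
next
  case (sos_fun_add_power2 G g)
  from sos_fun.sos_fun_add_power2[OF this(3,2)] show ?case
    by (simp add: add.assoc)
qed

lemma sos_fun_mult_power2:
  assumes "form_fun k l" "sos_fun d F"
  shows "sos_fun (k + d) (\<lambda>v. (l v)\<^sup>2 * F v)"
  using assms(2)
proof induction
  case sos_fun_zero
  then show ?case using sos_fun.sos_fun_zero by simp
next
  case (sos_fun_add_power2 F g)
  from sos_fun.sos_fun_add_power2[OF this(3) form_fun_mult[OF assms(1) this(2)]] show ?case
    by (simp add: algebra_simps)
qed

lemma sos_fun_cmult: "c \<ge> 0 \<Longrightarrow> sos_fun d F \<Longrightarrow> sos_fun d (\<lambda>v. c * F v)"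
  using sos_fun_mult_power2[OF form_fun_const[of "sqrt c"], of d F] by simp

lemma sos_fun_sum:
  "finite A \<Longrightarrow> (\<And>i. i \<in> A \<Longrightarrow> sos_fun d (F i)) \<Longrightarrow> sos_fun d (\<lambda>v. \<Sum>i\<in>A. F i v)"
  by (induction A rule: finite_induct) (auto intro: sos_fun_zero sos_fun_add)

lemma sos_fun_linear_compose:
  assumes "sos_fun d F" "linear L"
  shows "sos_fun d (\<lambda>v. F (L v))"
  using assms(1)
proof induction
  case sos_fun_zero
  then show ?case by (rule sos_fun.sos_fun_zero)
next
  case (sos_fun_add_power2 F g)
  from sos_fun.sos_fun_add_power2[OF this(3) form_fun_linear_compose[OF this(2) assms(2)]]
  show ?case .
qed

lemma sos_fun_norm_power: "sos_fun d (\<lambda>v :: real ^ 'n::finite. (v \<bullet> v) ^ d)"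
proof (induction d)
  case 0
  show ?case using sos_fun_power2[OF form_fun_const[of 1]] by simp
next
  case (Suc d)
  have "sos_fun (1 + d) (\<lambda>v :: real ^ 'n. \<Sum>i\<in>UNIV. (v $ i)\<^sup>2 * (v \<bullet> v) ^ d)"
    by (intro sos_fun_sum sos_fun_mult_power2 form_fun_component Suc) auto
  then show ?case
    by (simp add: inner_vec_def power2_eq_square flip: sum_distrib_right)
qed

lemma sos_fun_form_sos:
  assumes "sos_fun d F"
  shows "\<exists>f\<in>sos_forms d. F = poly_eval f"
  using assms
proof induction
  case sos_fun_zero
  have "0 \<in> sos_forms d"
    unfolding sos_forms_def by (auto intro!: exI[of _ 0])
  then show ?case by (intro bexI[of _ 0]) auto
next
  case (sos_fun_add_power2 F g)
  obtain m :: nat and q where q: "\<And>i. i < m \<Longrightarrow> q i \<in> forms d" "F = poly_eval (\<Sum>i<m. (q i)\<^sup>2)"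
    using sos_fun_add_power2.IH by (auto simp: sos_forms_def)
  obtain p where p: "p \<in> forms d" "g = poly_eval p"
    using sos_fun_add_power2.hyps by (auto simp: form_fun_def)
  let ?q = "q(m := p)"
  have "(\<Sum>i<Suc m. (?q i)\<^sup>2) = (\<Sum>i<m. (q i)\<^sup>2) + p\<^sup>2"
    by simp
  moreover have "\<forall>i<Suc m. ?q i \<in> forms d"
    using q(1) p(1) by (simp add: less_Suc_eq)
  ultimately have "(\<Sum>i<m. (q i)\<^sup>2) + p\<^sup>2 \<in> sos_forms d"
    unfolding sos_forms_def by (intro CollectI exI[of _ "Suc m"] exI[of _ ?q] conjI) auto
  then show ?case
    by (rule rev_bexI) (simp add: q(2) p(2) fun_eq_iff)
qed


subsection \<open>Quadratic forms\<close>

text \<open>The discriminant argument, with the degenerate case \<open>f = 0\<close>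
  included.\<close>

lemma quadratic_nonneg:
  fixes f g h :: real
  assumes "\<And>x. x\<^sup>2 * f + 2 * x * g + h \<ge> 0"
  shows "f \<ge> 0" "h \<ge> 0" "g\<^sup>2 \<le> f * h"
proof -
  show h: "h \<ge> 0"
    using assms[of 0] by simp
  show f: "f \<ge> 0"
  proof (rule ccontr)
    assume "\<not> f \<ge> 0"
    \<comment> \<open>\<open>t\<close> satisfies \<open>t^2 * f = - (h + 1)\<close>, so that the
      values at \<open>t\<close> and \<open>- t\<close> add up to -2.\<close>
    define t where "t = sqrt ((h + 1) / (- f))"
    have "t\<^sup>2 = (h + 1) / (- f)"
      unfolding t_def using h \<open>\<not> f \<ge> 0\<close> by (intro real_sqrt_pow2 divide_nonneg_pos) auto
    then have "t\<^sup>2 * f = - (h + 1)"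
      using \<open>\<not> f \<ge> 0\<close> by (simp add: field_simps)
    then show False
      using assms[of t] assms[of "- t"] by simp
  qed
  show "g\<^sup>2 \<le> f * h"
  proof (cases "f = 0")
    case True
    \<comment> \<open>Otherwise the value at \<open>- (h + 1) / (2 * g)\<close> would be -1.\<close>
    then have "g = 0"
      using assms[of "- (h + 1) / (2 * g)"] by (cases "g = 0") (auto simp: field_simps)
    then show ?thesis using True by simp
  next
    case False
    then show ?thesis
      using f assms[of "- g / f"] by (simp add: field_simps power2_eq_square)
  qed
qed

text \<open>Lagrange's reduction: completing the square in direction \<open>i\<close> puts that axis
  into the radical of the remaining form. \<open>S\<close> collects the axes still to be treated;
  once it is empty the form is zero.\<close>

lemma psd_bilinear_sos:
  fixes B :: "real ^ 'n::finite \<Rightarrow> real ^ 'n \<Rightarrow> real"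
  assumes "finite S" "bilinear B" "\<And>u v. B u v = B v u" "\<And>v. B v v \<ge> 0"
    "\<And>j v. j \<notin> S \<Longrightarrow> B (axis j 1) v = 0"
  shows "sos_fun 1 (\<lambda>v. B v v)"
  using assms
proof (induction S arbitrary: B rule: finite_induct)
  case empty
  have "B v w = 0" for v w
  proof -
    have l: "linear (\<lambda>v. B v w)"
      using empty.prems(1) by (simp add: bilinear_def)
    have "B v w = B (\<Sum>i\<in>UNIV. v $ i *\<^sub>R axis i 1) w"
      by (simp add: basis_expansion flip: scalar_mult_eq_scaleR)
    also have "\<dots> = 0"
      using empty.prems(4) by (simp add: linear_sum[OF l] linear_cmul[OF l])
    finally show ?thesis .
  qed
  then show ?case by (simp add: sos_fun_zero)
next
  case (insert i S)
  let ?e = "axis i 1 :: real ^ 'n"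
  note bil = insert.prems(1)
  note B = bilinear_ladd[OF bil] bilinear_radd[OF bil] bilinear_lmul[OF bil] bilinear_rmul[OF bil]
  \<comment> \<open>If \<open>B ?e ?e = 0\<close>, the quotient is 0 by convention and
    \<open>B' = B\<close>; this is right because \<open>cs\<close> then makes \<open>B ?e\<close>
    vanish.\<close>
  define B' where "B' u v = B u v - B ?e u * B ?e v / B ?e ?e" for u v
  have cs: "(B ?e v)\<^sup>2 \<le> B ?e ?e * B v v" for v
  proof (rule quadratic_nonneg)
    fix x
    have "B (x *\<^sub>R ?e + v) (x *\<^sub>R ?e + v) = x\<^sup>2 * B ?e ?e + 2 * x * B ?e v + B v v"
      by (simp add: B insert.prems(2)[of v ?e] power2_eq_square distrib_left)
    then show "x\<^sup>2 * B ?e ?e + 2 * x * B ?e v + B v v \<ge> 0"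
      using insert.prems(3)[of "x *\<^sub>R ?e + v"] by simp
  qed
  have sym: "B' u v = B' v u" for u v
    by (simp add: B'_def insert.prems(2)[of u v])
  have lin: "linear (B' u)" for u
  proof -
    have "linear (\<lambda>v. B u v - (B ?e u / B ?e ?e) *\<^sub>R B ?e v)"
      using bil by (intro linear_compose_sub linear_compose_scale_right) (simp_all add: bilinear_def)
    then show ?thesis
      by (simp add: B'_def[abs_def])
  qed
  have "linear (\<lambda>u. B' u v)" for v
    using lin[of v] by (subst sym)
  with lin have "bilinear B'"
    unfolding bilinear_def by blast
  moreover have "B' v v \<ge> 0" for v
    using cs[of v] insert.prems(3)[of v] insert.prems(3)[of ?e]
    by (cases "B ?e ?e = 0") (auto simp: B'_def field_simps power2_eq_square)
  moreover have "B' (axis j 1) v = 0" if "j \<notin> S" for j v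
  proof (cases "j = i")
    case True
    then show ?thesis
      using cs[of v] by (cases "B ?e ?e = 0") (auto simp: B'_def)
  next
    case False
    then have "B (axis j 1) u = 0" for u
      using that insert.prems(4) by simp
    then show ?thesis
      using insert.prems(2)[of ?e "axis j 1"] by (simp add: B'_def)
  qed
  ultimately have "sos_fun 1 (\<lambda>v. B' v v)"
    using sym by (intro insert.IH)
  moreover have "linear (B ?e)"
    using bil by (simp add: bilinear_def)
  then have "sos_fun 1 (\<lambda>v. (1 / B ?e ?e) * (B ?e v)\<^sup>2)"
    using insert.prems(3)[of ?e] by (intro sos_fun_cmult sos_fun_power2 form_fun_linear) auto
  ultimately have "sos_fun 1 (\<lambda>v. B' v v + (1 / B ?e ?e) * (B ?e v)\<^sup>2)"
    by (rule sos_fun_add)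
  then show ?case
    by (rule sos_fun_cong) (simp add: B'_def power2_eq_square)
qed

lemma quadratic_sos:
  fixes F :: "real ^ 'n::finite \<Rightarrow> real"
  assumes "form_fun 2 F" "\<And>v. F v \<ge> 0"
  shows "sos_fun 1 F"
proof -
  obtain a where a: "\<And>v. F v = (\<Sum>i\<in>UNIV. \<Sum>j\<in>UNIV. a i j * (v $ i * v $ j))"
    using quadratic_form_fun[OF assms(1)] by blast
  \<comment> \<open>Averaging over the two orders of the arguments gives symmetry without changing
    the values on the diagonal.\<close>
  define B where "B u v = (\<Sum>i\<in>UNIV. \<Sum>j\<in>UNIV. a i j / 2 * (u $ i * v $ j + u $ j * v $ i))" for u v
  have "B v v = F v" for v
    unfolding B_def a by (intro sum.cong refl) simp
  moreover have "bilinear B"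
    unfolding bilinear_def B_def
    by (auto intro!: linearI simp: algebra_simps add_divide_distrib sum.distrib sum_distrib_left)
  moreover have "B u v = B v u" for u v
    unfolding B_def by (intro sum.cong refl) (simp add: algebra_simps)
  ultimately show ?thesis
    using psd_bilinear_sos[of UNIV B] assms(2) by simp
qed


subsection \<open>Binary forms\<close>

text \<open>Serves to place a zero of a form on a coordinate axis; for binary forms, vanishing there
  becomes divisibility by the other coordinate.\<close>

lemma rotate_axis:
  fixes u :: "real ^ 'n::finite"
  assumes "norm u = 1"
  obtains A B :: "real ^ 'n \<Rightarrow> real ^ 'n" where "linear A" "linear B" "A (axis i 1) = u" "\<And>v. A (B v) = v" "\<And>v. norm (A v) = norm v"
proof -
  obtain A :: "real ^ 'n \<Rightarrow> real ^ 'n" where A: "orthogonal_transformation A" "A (axis i 1) = u"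
    using orthogonal_transformation_exists[of "axis i 1" u] assms by auto
  have "A (inv A v) = v" for v
    using orthogonal_transformation_surj[OF A(1)] by (rule surj_f_inv_f)
  with A orthogonal_transformation_inv[OF A(1)] show ?thesis
    by (intro that[of A "inv A"]) (auto simp: orthogonal_transformation)
qed

lemma vec2_eq_axis:
  fixes v :: "real ^ 2"
  shows "v $ 1 = 0 \<Longrightarrow> v = v $ 2 *\<^sub>R axis 2 1" "v $ 2 = 0 \<Longrightarrow> v = v $ 1 *\<^sub>R axis 1 1"
  by (simp_all add: vec_eq_iff forall_2 axis_def)

text \<open>Induction on half the degree: subtracting a multiple of a power of the squared norm
  creates a zero \<open>u\<close>, hence a line of zeros. With \<open>u\<close> rotated to axis 2
  this line is \<open>v $ 1 = 0\<close>, and the square of \<open>v $ 1\<close> splits off.\<close>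

lemma binary_sos:
  fixes F :: "real ^ 2 \<Rightarrow> real"
  assumes "form_fun (2 * d) F" "\<And>v. F v \<ge> 0"
  shows "sos_fun d F"
  using assms
proof (induction d arbitrary: F)
  case 0
  have "sos_fun 0 (\<lambda>v. (sqrt (F 0))\<^sup>2)"
    by (intro sos_fun_power2 form_fun_const)
  then show ?case
  proof (rule sos_fun_cong)
    show "F v = (sqrt (F 0))\<^sup>2" for v
      using form_fun_degree_0[of F v] 0 by simp
  qed
next
  case (Suc d)
  obtain u where u: "norm u = 1"
    "\<And>v. F v - F u / (u \<bullet> u) ^ Suc d * (v \<bullet> v) ^ Suc d \<ge> 0"
    using form_fun_min[OF Suc.prems(1) form_fun_norm_power] by auto
  define m where "m = F u"
  have "u \<bullet> u = 1"
    using u(1) by (simp add: norm_eq_1)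
  define F' where "F' v = F v - m * (v \<bullet> v) ^ Suc d" for v
  have F': "form_fun (2 * Suc d) F'" "\<And>v. F' v \<ge> 0" "F' u = 0"
    unfolding F'_def m_def
    using form_fun_diff[OF Suc.prems(1) form_fun_cmult[OF form_fun_norm_power]] u(2) \<open>u \<bullet> u = 1\<close>
    by simp_all
  obtain A B :: "real ^ 2 \<Rightarrow> real ^ 2" where A: "linear A" "linear B" "A (axis 2 1) = u" "\<And>v. A (B v) = v"
    using rotate_axis[OF u(1), of 2] by blast
  have "F' (A v) = 0" if "v $ 1 = 0" for v
  proof -
    have "A v = v $ 2 *\<^sub>R u"
      using vec2_eq_axis(1)[OF that] linear_cmul[OF A(1)] A(3) by metis
    then show ?thesis
      using form_fun_scaleR[OF F'(1)] F'(3) by simp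
  qed
  moreover have "form_fun (Suc (Suc (2 * d))) (\<lambda>v. F' (A v))"
    using form_fun_linear_compose[OF F'(1) A(1)] by simp
  ultimately obtain K where K: "form_fun (2 * d) K" "\<And>v. F' (A v) = (v $ 1)\<^sup>2 * K v" "\<And>v. K v \<ge> 0"
    using form_fun_psd_factor[of "2 * d" "\<lambda>v. F' (A v)" 1] F'(2) by blast
  have "sos_fun (1 + d) (\<lambda>v. (v $ 1)\<^sup>2 * K v)"
    by (intro sos_fun_mult_power2 form_fun_component Suc.IH K)
  from sos_fun_linear_compose[OF this A(2)] have "sos_fun (Suc d) F'"
    by (simp add: A(4) flip: K(2))
  moreover have "sos_fun (Suc d) (\<lambda>v :: real ^ 2. m * (v \<bullet> v) ^ Suc d)"
    using Suc.prems(2) by (intro sos_fun_cmult sos_fun_norm_power) (simp add: m_def)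
  ultimately have "sos_fun (Suc d) (\<lambda>v. F' v + m * (v \<bullet> v) ^ Suc d)"
    by (rule sos_fun_add)
  then show ?case
    by (rule sos_fun_cong) (simp add: F'_def)
qed


subsection \<open>Ternary quartics\<close>

text \<open>Division off the hyperplane, continuity on it. Passes a discriminant bound on to the
  cofactors.\<close>

lemma square_le_mult_cancel:
  fixes f g h :: "real ^ 'n::finite \<Rightarrow> real"
  assumes "form_fun k f" "form_fun l g" "form_fun m h"
    and "\<And>v. (v $ i * g v)\<^sup>2 \<le> f v * ((v $ i)\<^sup>2 * h v)"
  shows "(g v)\<^sup>2 \<le> f v * h v"
proof -
  have "f v * h v - (g v)\<^sup>2 \<ge> 0" if "v $ i \<noteq> 0" for v
  proof -
    have "(v $ i)\<^sup>2 * (f v * h v - (g v)\<^sup>2) \<ge> 0"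
      using assms(4)[of v] by (simp add: algebra_simps power_mult_distrib)
    then show ?thesis
      using that by (simp add: zero_le_mult_iff)
  qed
  moreover have "continuous_on UNIV (\<lambda>v. f v * h v - (g v)\<^sup>2)"
    by (intro continuous_intros form_fun_continuous[OF assms(1)] form_fun_continuous[OF assms(2)]
        form_fun_continuous[OF assms(3)])
  ultimately show ?thesis
    using nonneg_off_hyperplane[of "\<lambda>v. f v * h v - (g v)\<^sup>2" i v] by simp
qed

text \<open>
  If \<open>f\<close> and \<open>f h - g\<^sup>2\<close> are positive definite, then subtracting \<open>\<mu> Z\<^sup>2 f\<close> makes \<open>f h - g\<^sup>2\<close> vanish at
  some \<open>u\<close>. A shift of \<open>X\<close> by a multiple of \<open>Z\<close> moves this zero to \<open>g\<close> and \<open>h\<close>.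
\<close>

lemma biquadratic_sos:
  fixes f g h :: "real ^ 2 \<Rightarrow> real" and X Z :: "real ^ 'n::finite \<Rightarrow> real" and W :: "real ^ 'n \<Rightarrow> real ^ 2"
  assumes f: "form_fun 2 f" "\<And>w. w \<noteq> 0 \<Longrightarrow> f w > 0" and g: "form_fun 2 g" and h: "form_fun 2 h"
    and fgh: "\<And>w. (g w)\<^sup>2 \<le> f w * h w"
    and X: "form_fun 1 X" and Z: "form_fun 1 Z" and W: "linear W"
  shows "sos_fun 2 (\<lambda>v. (X v)\<^sup>2 * f (W v) + 2 * X v * Z v * g (W v) + (Z v)\<^sup>2 * h (W v))"
proof -
  have f_nonneg: "f w \<ge> 0" for w
    using f(2)[of w] form_fun_at_0[OF f(1)] by (cases "w = 0") auto
  have f_sos: "sos_fun 2 (\<lambda>v. (Y v)\<^sup>2 * f (W v))" if "form_fun 1 Y" for Y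
    using sos_fun_mult_power2[OF that sos_fun_linear_compose[OF quadratic_sos[OF f(1) f_nonneg] W]]
    unfolding one_add_one .
  have D: "form_fun 4 (\<lambda>w. f w * h w - (g w)\<^sup>2)"
    using form_fun_diff[OF form_fun_mult[OF f(1) h, simplified] form_fun_power2[OF g, simplified]] by simp
  have f4: "form_fun 4 (\<lambda>w. (f w)\<^sup>2)"
    using form_fun_power2[OF f(1)] by simp
  have "(f w)\<^sup>2 > 0" if "w \<noteq> 0" for w
    using f(2)[OF that] by simp
  from form_fun_min[OF D f4 this] obtain u where u: "norm u = 1"
    "\<And>w. f w * h w - (g w)\<^sup>2 - (f u * h u - (g u)\<^sup>2) / (f u)\<^sup>2 * (f w)\<^sup>2 \<ge> 0"
    by blast
  \<comment> \<open>The least value of \<open>(f h - g^2) / f^2\<close> on the circle, attained at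
    \<open>u\<close>.\<close>
  define \<mu> where "\<mu> = (f u * h u - (g u)\<^sup>2) / (f u)\<^sup>2"
  have "\<mu> \<ge> 0"
    using fgh[of u] by (simp add: \<mu>_def)
  have "u \<noteq> 0"
    using u(1) by force
  then have fu: "f u > 0"
    by (rule f(2))
  \<comment> \<open>Chosen to make \<open>g'\<close> vanish at \<open>u\<close>. Below,
    \<open>g'\<close> and \<open>h'\<close> are the coefficients after the substitution
    \<open>X = Y + \<alpha> * Z\<close>, with \<open>\<mu> * f\<close> removed from
    \<open>h\<close>.\<close>
  define \<alpha> where "\<alpha> = - g u / f u"
  define g' where "g' w = g w + \<alpha> * f w" for w
  define h' where "h' w = (h w - \<mu> * f w) + (2 * \<alpha> * g w + \<alpha>\<^sup>2 * f w)" for w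
  have g': "form_fun 2 g'"
    unfolding g'_def by (intro form_fun_add form_fun_cmult f g)
  have h': "form_fun 2 h'"
    unfolding h'_def by (intro form_fun_add form_fun_diff form_fun_cmult f g h)
  \<comment> \<open>The shift of \<open>X\<close> leaves the discriminant unchanged, so only the
    \<mu>-term appears; the right side vanishes at \<open>u\<close>.\<close>
  have disc: "f w * h' w - (g' w)\<^sup>2 = f w * h w - (g w)\<^sup>2 - \<mu> * (f w)\<^sup>2" for w
    by (simp add: g'_def h'_def power2_eq_square algebra_simps)
  have fgh': "(g' w)\<^sup>2 \<le> f w * h' w" for w
    using disc[of w] u(2)[of w] unfolding \<mu>_def by linarith
  have h'_nonneg: "h' w \<ge> 0" for w
  proof (cases "w = 0")
    case True
    then show ?thesis using form_fun_at_0[OF h'] by simp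
  next
    case False
    have "0 \<le> f w * h' w"
      using fgh'[of w] zero_le_power2[of "g' w"] by linarith
    then show ?thesis
      using f(2)[OF False] by (simp add: zero_le_mult_iff)
  qed
  have g'u: "g' u = 0"
    using fu by (simp add: g'_def \<alpha>_def)
  have "f u * h' u = 0"
    using disc[of u] g'u fu by (simp add: \<mu>_def)
  then have h'u: "h' u = 0"
    using fu by simp
  obtain A B :: "real ^ 2 \<Rightarrow> real ^ 2" where A: "linear A" "linear B" "A (axis 1 1) = u" "\<And>v. A (B v) = v"
    using rotate_axis[OF u(1), of 1] by blast
  have "A v = v $ 1 *\<^sub>R u" if "v $ 2 = 0" for v
    using vec2_eq_axis(2)[OF that] linear_cmul[OF A(1)] A(3) by metis
  then have zero: "g' (A v) = 0" "h' (A v) = 0" if "v $ 2 = 0" for v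
    using that form_fun_scaleR[OF g'] form_fun_scaleR[OF h'] g'u h'u by simp_all
  obtain m where m: "form_fun 1 m" "\<And>v. g' (A v) = v $ 2 * m v"
    using form_fun_factor[of 1 "\<lambda>v. g' (A v)" 2] form_fun_linear_compose[OF g' A(1)] zero(1)
    by (auto simp: numeral_2_eq_2)
  obtain K where K: "form_fun 0 K" "\<And>v. h' (A v) = (v $ 2)\<^sup>2 * K v" "\<And>v. K v \<ge> 0"
    using form_fun_psd_factor[of 0 "\<lambda>v. h' (A v)" 2] form_fun_linear_compose[OF h' A(1)] zero(2) h'_nonneg
    by (auto simp: numeral_2_eq_2)
  define \<kappa> where "\<kappa> = K 0"
  have \<kappa>: "K v = \<kappa>" for v
    unfolding \<kappa>_def by (rule form_fun_degree_0[OF K(1)])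
  have "\<kappa> \<ge> 0"
    using K(3) by (simp add: \<kappa>_def)
  have fA: "form_fun 2 (\<lambda>v. f (A v))"
    by (rule form_fun_linear_compose[OF f(1) A(1)])
  have fmK: "(m v)\<^sup>2 \<le> f (A v) * K v" for v
    by (rule square_le_mult_cancel[OF fA m(1) K(1), of 2]) (use fgh'[of "A _"] in \<open>simp add: m(2) K(2)\<close>)
  define V where "V v = B (W v)" for v
  have V: "linear V"
    using linear_compose[OF W A(2)] by (simp add: V_def[abs_def] o_def)
  have AV: "W v = A (V v)" for v
    by (simp add: V_def A(4))
  define Y where "Y v = X v - \<alpha> * Z v" for v
  have Y: "form_fun 1 Y"
    unfolding Y_def by (intro form_fun_diff form_fun_cmult X Z)
  have mV: "form_fun 1 (\<lambda>v. m (V v))"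
    by (rule form_fun_linear_compose[OF m(1) V])
  have l: "form_fun 1 (\<lambda>v. V v $ 2)"
    using form_fun_linear_compose[OF form_fun_component V] .
  let ?T = "\<lambda>v. (Y v)\<^sup>2 * f (A (V v)) + 2 * Y v * Z v * (V v $ 2 * m (V v)) + (Z v)\<^sup>2 * ((V v $ 2)\<^sup>2 * \<kappa>)"
  have T: "sos_fun 2 ?T"
  proof (cases "\<kappa> = 0")
    case True
    then have "m v = 0" for v
      using fmK[of v] by (simp add: \<kappa>)
    then show ?thesis
      using f_sos[OF Y] by (simp add: True flip: AV)
  next
    case False
    with \<open>\<kappa> \<ge> 0\<close> have "\<kappa> > 0" by simp
    have "form_fun (1 + 1) (\<lambda>v. \<kappa> * (Z v * V v $ 2) + Y v * m (V v))"
      by (intro form_fun_add form_fun_cmult form_fun_mult Y Z l mV)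
    from sos_fun_power2[OF this]
    have 1: "sos_fun 2 (\<lambda>v. (\<kappa> * (Z v * V v $ 2) + Y v * m (V v))\<^sup>2)"
      unfolding one_add_one .
    have "form_fun 2 (\<lambda>v. \<kappa> * f (A v) - (m v)\<^sup>2)"
      using form_fun_diff[OF form_fun_cmult[OF fA] form_fun_power2[OF m(1), unfolded mult_1_right]] .
    then have "sos_fun 1 (\<lambda>v. \<kappa> * f (A v) - (m v)\<^sup>2)"
      by (rule quadratic_sos) (use fmK in \<open>simp add: \<kappa> mult.commute\<close>)
    from sos_fun_mult_power2[OF Y sos_fun_linear_compose[OF this V]]
    have 2: "sos_fun 2 (\<lambda>v. (Y v)\<^sup>2 * (\<kappa> * f (A (V v)) - (m (V v))\<^sup>2))"
      unfolding one_add_one .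
    \<comment> \<open>Completing the square in \<open>Z v * V v $ 2\<close>: the bracket is \<kappa>
      times \<open>?T\<close>, and its second summand contains the quadric
      \<open>\<kappa> f - m^2\<close>, nonnegative by \<open>fmK\<close>.\<close>
    have "sos_fun 2 (\<lambda>v. (1 / \<kappa>) * ((\<kappa> * (Z v * V v $ 2) + Y v * m (V v))\<^sup>2
        + (Y v)\<^sup>2 * (\<kappa> * f (A (V v)) - (m (V v))\<^sup>2)))"
      using \<open>\<kappa> > 0\<close> by (intro sos_fun_cmult sos_fun_add 1 2) simp
    then show ?thesis
      by (rule sos_fun_cong) (use \<open>\<kappa> > 0\<close> in \<open>simp add: field_simps power2_eq_square\<close>)
  qed
  have "sos_fun 2 (\<lambda>v. ?T v + \<mu> * ((Z v)\<^sup>2 * f (W v)))"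
    by (intro sos_fun_add T sos_fun_cmult \<open>\<mu> \<ge> 0\<close> f_sos Z)
  then show ?thesis
  proof (rule sos_fun_cong)
    fix v
    have gm: "V v $ 2 * m (V v) = g' (W v)"
      using m(2)[of "V v"] by (simp add: AV)
    have hK: "(V v $ 2)\<^sup>2 * \<kappa> = h' (W v)"
      using K(2)[of "V v"] by (simp add: AV \<kappa>)
    show "(X v)\<^sup>2 * f (W v) + 2 * X v * Z v * g (W v) + (Z v)\<^sup>2 * h (W v)
      = ?T v + \<mu> * ((Z v)\<^sup>2 * f (W v))"
      unfolding gm hK AV[symmetric] Y_def g'_def h'_def
      by (simp add: power2_eq_square algebra_simps)
  qed
qed

text \<open>At the zero \<open>u\<close> of \<open>f\<close> the bound on \<open>g^2\<close> forces
  \<open>g\<close> to vanish too. With \<open>u\<close> on axis 2 this gives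
  \<open>f = a v1^2\<close> and \<open>g = v1 m\<close>, and \<open>a\<close> times the quartic is
  \<open>(a X v1 + m)^2 + (a h - m^2)\<close>, where the last term is a nonnegative binary quartic.
  For \<open>a = 0\<close> only \<open>h\<close> remains.\<close>

lemma quartic_degenerate_sos:
  fixes f g h :: "real ^ 2 \<Rightarrow> real" and X :: "real ^ 'n::finite \<Rightarrow> real" and W :: "real ^ 'n \<Rightarrow> real ^ 2"
  assumes f: "form_fun 2 f" and g: "form_fun 3 g" and h: "form_fun 4 h"
    and nonneg: "\<And>w. f w \<ge> 0" "\<And>w. h w \<ge> 0" "\<And>w. (g w)\<^sup>2 \<le> f w * h w"
    and u: "norm u = 1" "f u = 0" and X: "form_fun 1 X" and W: "linear W"
  shows "sos_fun 2 (\<lambda>v. (X v)\<^sup>2 * f (W v) + 2 * X v * g (W v) + h (W v))"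
proof -
  obtain A B :: "real ^ 2 \<Rightarrow> real ^ 2" where A: "linear A" "linear B" "A (axis 2 1) = u" "\<And>v. A (B v) = v"
    using rotate_axis[OF u(1), of 2] by blast
  have "A v = v $ 2 *\<^sub>R u" if "v $ 1 = 0" for v
    using vec2_eq_axis(1)[OF that] linear_cmul[OF A(1)] A(3) by metis
  then have fzero: "f (A v) = 0" if "v $ 1 = 0" for v
    using that form_fun_scaleR[OF f] u(2) by simp
  then have gzero: "g (A v) = 0" if "v $ 1 = 0" for v
    using nonneg(3)[of "A v"] that by simp
  obtain K where K: "form_fun 0 K" "\<And>v. f (A v) = (v $ 1)\<^sup>2 * K v" "\<And>v. K v \<ge> 0"
    using form_fun_psd_factor[of 0 "\<lambda>v. f (A v)" 1] form_fun_linear_compose[OF f A(1)] fzero nonneg(1)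
    by (auto simp: numeral_2_eq_2)
  define a where "a = K 0"
  have a: "K v = a" for v
    unfolding a_def by (rule form_fun_degree_0[OF K(1)])
  have "a \<ge> 0"
    using K(3) by (simp add: a_def)
  obtain m where m: "form_fun 2 m" "\<And>v. g (A v) = v $ 1 * m v"
    using form_fun_factor[of 2 "\<lambda>v. g (A v)" 1] form_fun_linear_compose[OF g A(1)] gzero
    by (auto simp: numeral_2_eq_2 numeral_3_eq_3)
  have hA: "form_fun 4 (\<lambda>v. h (A v))"
    by (rule form_fun_linear_compose[OF h A(1)])
  have hmK: "(m v)\<^sup>2 \<le> h (A v) * K v" for v
    by (rule square_le_mult_cancel[OF hA m(1) K(1), of 1])
      (use nonneg(3)[of "A _"] in \<open>simp add: m(2) K(2) mult_ac\<close>)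
  define V where "V v = B (W v)" for v
  have V: "linear V"
    using linear_compose[OF W A(2)] by (simp add: V_def[abs_def] o_def)
  have AV: "W v = A (V v)" for v
    by (simp add: V_def A(4))
  have "sos_fun 2 (\<lambda>v. (X v)\<^sup>2 * ((V v $ 1)\<^sup>2 * a) + 2 * X v * (V v $ 1 * m (V v)) + h (A (V v)))"
  proof (cases "a = 0")
    case True
    then have "m v = 0" for v
      using hmK[of v] by (simp add: a)
    moreover have "sos_fun 2 h"
      by (rule binary_sos) (use h nonneg(2) in auto)
    from sos_fun_linear_compose[OF this W] have "sos_fun 2 (\<lambda>v. h (A (V v)))"
      by (simp flip: AV)
    ultimately show ?thesis by (simp add: True)
  next
    case False
    with \<open>a \<ge> 0\<close> have "a > 0" by simp
    have "form_fun 2 (\<lambda>v. a * (X v * V v $ 1))"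
      using form_fun_cmult[OF form_fun_mult[OF X form_fun_linear_compose[OF form_fun_component V]]]
      unfolding one_add_one .
    then have 1: "sos_fun 2 (\<lambda>v. (a * (X v * V v $ 1) + m (V v))\<^sup>2)"
      by (intro sos_fun_power2 form_fun_add form_fun_linear_compose[OF m(1) V])
    have "form_fun 4 (\<lambda>v. a * h (A v) - (m v)\<^sup>2)"
      using form_fun_diff[OF form_fun_cmult[OF hA] form_fun_power2[OF m(1), simplified]] .
    then have "sos_fun 2 (\<lambda>v. a * h (A v) - (m v)\<^sup>2)"
      by (intro binary_sos) (use hmK in \<open>simp_all add: a mult.commute\<close>)
    from sos_fun_linear_compose[OF this V]
    have 2: "sos_fun 2 (\<lambda>v. a * h (A (V v)) - (m (V v))\<^sup>2)" .
    have "sos_fun 2 (\<lambda>v. (1 / a) * ((a * (X v * V v $ 1) + m (V v))\<^sup>2 + (a * h (A (V v)) - (m (V v))\<^sup>2)))"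
      using \<open>a > 0\<close> by (intro sos_fun_cmult sos_fun_add 1 2) simp
    then show ?thesis
      by (rule sos_fun_cong) (use \<open>a > 0\<close> in \<open>simp add: field_simps power2_eq_square\<close>)
  qed
  then show ?thesis
  proof (rule sos_fun_cong)
    fix v
    have "(V v $ 1)\<^sup>2 * a = f (W v)" "V v $ 1 * m (V v) = g (W v)"
      using K(2)[of "V v"] m(2)[of "V v"] by (simp_all add: AV a)
    then show "(X v)\<^sup>2 * f (W v) + 2 * X v * g (W v) + h (W v)
      = (X v)\<^sup>2 * ((V v $ 1)\<^sup>2 * a) + 2 * X v * (V v $ 1 * m (V v)) + h (A (V v))"
      by (simp flip: AV)
  qed
qed

text \<open>
  If \<open>f\<close> and \<open>f h - g\<^sup>2\<close> are positive definite, then subtracting \<open>\<epsilon> f\<^sup>2\<close> creates a second zero of the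
  quartic. In coordinates adapted to the two zeros, the quartic is quadratic in each of \<open>x\<close> and \<open>y\<close>.
\<close>

lemma quartic_with_zero_sos:
  fixes f g h :: "real ^ 2 \<Rightarrow> real" and X :: "real ^ 'n::finite \<Rightarrow> real" and W :: "real ^ 'n \<Rightarrow> real ^ 2"
  assumes f: "form_fun 2 f" and g: "form_fun 3 g" and h: "form_fun 4 h"
    and nonneg: "\<And>x w. x\<^sup>2 * f w + 2 * x * g w + h w \<ge> 0"
    and X: "form_fun 1 X" and W: "linear W"
  shows "sos_fun 2 (\<lambda>v. (X v)\<^sup>2 * f (W v) + 2 * X v * g (W v) + h (W v))"
proof (cases "\<exists>w. w \<noteq> 0 \<and> f w = 0")
  case True
  note psd = quadratic_nonneg[OF nonneg]
  from True obtain w where w: "w \<noteq> 0" "f w = 0" by blast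
  show ?thesis
  proof (rule quartic_degenerate_sos[OF f g h psd _ _ X W])
    show "norm (w /\<^sub>R norm w) = 1" "f (w /\<^sub>R norm w) = 0"
      using w by (simp_all add: form_fun_scaleR[OF f])
  qed
next
  case False
  note psd = quadratic_nonneg[OF nonneg]
  have f_pos: "f w > 0" if "w \<noteq> 0" for w
    using False psd(1)[of w] that by (auto simp: less_le)
  have D: "form_fun 6 (\<lambda>w. f w * h w - (g w)\<^sup>2)"
    using form_fun_diff[OF form_fun_mult[OF f h, simplified] form_fun_power2[OF g, simplified]] by simp
  have f6: "form_fun 6 (\<lambda>w. (f w) ^ 3)"
    using form_fun_power[OF f, of 3] by simp
  from form_fun_min[OF D f6] f_pos obtain u where u: "norm u = 1"
    "\<And>w. f w * h w - (g w)\<^sup>2 - (f u * h u - (g u)\<^sup>2) / (f u) ^ 3 * (f w) ^ 3 \<ge> 0"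
    by (metis zero_less_power)
  \<comment> \<open>The least value of \<open>(f h - g^2) / f^3\<close> on the circle. Replacing
    \<open>h\<close> by \<open>h - \<epsilon> f^2\<close> lowers the discriminant by
    \<open>\<epsilon> f^3\<close>, so that it vanishes at \<open>u\<close>.\<close>
  define \<epsilon> where "\<epsilon> = (f u * h u - (g u)\<^sup>2) / (f u) ^ 3"
  have "u \<noteq> 0"
    using u(1) by force
  then have fu: "f u > 0"
    by (rule f_pos)
  have "\<epsilon> \<ge> 0"
    using psd(3)[of u] fu by (simp add: \<epsilon>_def)
  obtain A B :: "real ^ 2 \<Rightarrow> real ^ 2" where A: "linear A" "linear B" "A (axis 1 1) = u" "\<And>v. A (B v) = v"
      "\<And>v. norm (A v) = norm v"
    using rotate_axis[OF u(1), of 1] by blast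
  \<comment> \<open>Over \<open>u\<close> the reduced quartic has its zero at
    \<open>x = \<alpha>\<close>. Shifting \<open>x\<close> by \<open>\<alpha> * w $ 1\<close>, which
    is \<alpha> at the axis mapped to \<open>u\<close>, moves this zero to
    \<open>x = 0\<close>.\<close>
  define \<alpha> where "\<alpha> = - g u / f u"
  define f' where "f' w = f (A w)" for w
  define g' where "g' w = g (A w) + \<alpha> * (w $ 1 * f (A w))" for w
  define h' where "h' w = (h (A w) - \<epsilon> * (f (A w))\<^sup>2) + (2 * \<alpha> * (w $ 1 * g (A w)) + \<alpha>\<^sup>2 * ((w $ 1)\<^sup>2 * f (A w)))" for w
  note comp = form_fun_linear_compose[OF _ A(1)]
  have f': "form_fun 2 f'"
    unfolding f'_def by (rule comp[OF f])
  have f'_pos: "f' w > 0" if "w \<noteq> 0" for w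
    unfolding f'_def by (rule f_pos) (use that A(5)[of w] in force)
  have g': "form_fun 3 g'"
    unfolding g'_def
    using form_fun_mult[OF form_fun_component comp[OF f], of 1]
    by (intro form_fun_add form_fun_cmult comp[OF g]) (simp add: numeral_3_eq_3)
  have h': "form_fun 4 h'"
  proof -
    have 1: "form_fun 4 (\<lambda>w. (f (A w))\<^sup>2)"
      using form_fun_power2[OF comp[OF f]] by simp
    have 2: "form_fun 4 (\<lambda>w. w $ 1 * g (A w))"
      using form_fun_mult[OF form_fun_component comp[OF g]] by simp
    have 3: "form_fun 4 (\<lambda>w. (w $ 1)\<^sup>2 * f (A w))"
      using form_fun_mult[OF form_fun_power2[OF form_fun_component] comp[OF f]] by simp
    show ?thesis
      unfolding h'_def by (intro form_fun_add form_fun_diff form_fun_cmult comp[OF h] 1 2 3)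
  qed
  have disc: "f' w * h' w - (g' w)\<^sup>2 = f (A w) * h (A w) - (g (A w))\<^sup>2 - \<epsilon> * (f (A w)) ^ 3" for w
    by (simp add: f'_def g'_def h'_def power2_eq_square power3_eq_cube algebra_simps)
  have fgh': "(g' w)\<^sup>2 \<le> f' w * h' w" for w
    using disc[of w] u(2)[of "A w"] unfolding \<epsilon>_def by linarith
  have h'_nonneg: "h' w \<ge> 0" for w
  proof (cases "w = 0")
    case True
    then show ?thesis using form_fun_at_0[OF h'] by simp
  next
    case False
    have "0 \<le> f' w * h' w"
      using fgh'[of w] zero_le_power2[of "g' w"] by linarith
    then show ?thesis
      using f'_pos[OF False] by (simp add: zero_le_mult_iff)
  qed
  have g'u: "g' (axis 1 1) = 0"
    using fu by (simp add: g'_def \<alpha>_def A(3))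
  have "f' (axis 1 1) * h' (axis 1 1) = 0"
    using disc[of "axis 1 1"] g'u fu by (simp add: \<epsilon>_def A(3))
  then have h'u: "h' (axis 1 1) = 0"
    using f'_pos[of "axis 1 1"] by (auto simp: axis_eq_0_iff)
  have zero: "g' v = 0" "h' v = 0" if "v $ 2 = 0" for v
    using vec2_eq_axis(2)[OF that] form_fun_scaleR[OF g', of "v $ 1"] form_fun_scaleR[OF h', of "v $ 1"] g'u h'u
    by (metis mult_zero_right)+
  obtain m where m: "form_fun 2 m" "\<And>v. g' v = v $ 2 * m v"
    using form_fun_factor[of 2 g' 2] g' zero(1) by (auto simp: numeral_2_eq_2 numeral_3_eq_3)
  obtain K where K: "form_fun 2 K" "\<And>v. h' v = (v $ 2)\<^sup>2 * K v" "\<And>v. K v \<ge> 0"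
    using form_fun_psd_factor[of 2 h' 2] h' zero(2) h'_nonneg by (auto simp: eval_nat_numeral)
  have fmK: "(m v)\<^sup>2 \<le> f' v * K v" for v
    by (rule square_le_mult_cancel[OF f' m(1) K(1), of 2]) (use fgh' in \<open>simp add: m(2) K(2)\<close>)
  define V where "V v = B (W v)" for v
  have V: "linear V"
    using linear_compose[OF W A(2)] by (simp add: V_def[abs_def] o_def)
  have AV: "W v = A (V v)" for v
    by (simp add: V_def A(4))
  have V1: "form_fun 1 (\<lambda>v. V v $ i)" for i
    using form_fun_linear_compose[OF form_fun_component V] .
  define Y where "Y v = X v - \<alpha> * V v $ 1" for v
  have Y: "form_fun 1 Y"
    unfolding Y_def by (intro form_fun_diff form_fun_cmult X V1)
  let ?T = "\<lambda>v. (Y v)\<^sup>2 * f' (V v) + 2 * Y v * V v $ 2 * m (V v) + (V v $ 2)\<^sup>2 * K (V v)"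
  \<comment> \<open>Splitting \<open>v $ 2\<close> off \<open>g'\<close> and its square off
    \<open>h'\<close> has left three quadrics: the shape of \<open>biquadratic_sos\<close>, with
    \<open>V v $ 2\<close> in the role of \<open>Z\<close>.\<close>
  have T: "sos_fun 2 ?T"
    by (rule biquadratic_sos[OF f' f'_pos m(1) K(1) fmK Y V1 V])
  have "form_fun 2 (\<lambda>v. f (W v))"
    by (rule form_fun_linear_compose[OF f W])
  then have "sos_fun 2 (\<lambda>v. ?T v + \<epsilon> * (f (W v))\<^sup>2)"
    by (intro sos_fun_add T sos_fun_cmult \<open>\<epsilon> \<ge> 0\<close> sos_fun_power2)
  then show ?thesis
  proof (rule sos_fun_cong)
    fix v
    have gm: "2 * Y v * V v $ 2 * m (V v) = 2 * Y v * g' (V v)"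
      by (simp add: m(2))
    show "(X v)\<^sup>2 * f (W v) + 2 * X v * g (W v) + h (W v) = ?T v + \<epsilon> * (f (W v))\<^sup>2"
      unfolding gm
      unfolding K(2)[symmetric] Y_def f'_def g'_def h'_def AV[symmetric]
      by (simp add: power2_eq_square algebra_simps)
  qed
qed

section \<open>Reduction of ternary quartics to a zero on a coordinate axis\<close>

text \<open>Monomials are grouped by the exponent of variable \<open>i\<close>; the coefficients
  live on \<open>real ^ 2\<close> so that the results on binary forms apply.\<close>

lemma form_fun_expand_ternary:
  fixes F :: "real ^ 'n::finite \<Rightarrow> real"
  assumes "form_fun k F" and ijl: "(UNIV :: 'n set) = {i, j, l}" "i \<noteq> j" "i \<noteq> l" "j \<noteq> l"
  obtains G :: "nat \<Rightarrow> real ^ 2 \<Rightarrow> real" where "\<And>a. a \<le> k \<Longrightarrow> form_fun (k - a) (G a)"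
    "\<And>v. F v = (\<Sum>a\<le>k. (v $ i) ^ a * G a (vector [v $ j, v $ l]))"
proof -
  obtain A c where A: "finite A" "\<And>\<alpha>. \<alpha> \<in> A \<Longrightarrow> (\<Sum>i\<in>UNIV. \<alpha> $ i) = k"
    "\<And>v. F v = (\<Sum>\<alpha>\<in>A. c \<alpha> * monomial_fun \<alpha> v)"
    using form_fun_monomials[OF assms(1)] by blast
  have deg: "\<alpha> $ i + (\<alpha> $ j + \<alpha> $ l) = k" if "\<alpha> \<in> A" for \<alpha>
    using A(2)[OF that] ijl(2-4) unfolding ijl(1) by simp
  have mon: "monomial_fun \<alpha> v = (v $ i) ^ (\<alpha> $ i) * ((v $ j) ^ (\<alpha> $ j) * (v $ l) ^ (\<alpha> $ l))" for \<alpha> and v :: "real ^ 'n"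
    unfolding monomial_fun_def ijl(1) using ijl(2-4) by simp
  let ?A = "\<lambda>a. {\<alpha>\<in>A. \<alpha> $ i = a}"
  show ?thesis
  proof (rule that)
    fix a assume "a \<le> k"
    show "form_fun (k - a) (\<lambda>w :: real ^ 2. \<Sum>\<alpha>\<in>?A a. c \<alpha> * ((w $ 1) ^ (\<alpha> $ j) * (w $ 2) ^ (\<alpha> $ l)))"
    proof (intro form_fun_sum form_fun_cmult)
      fix \<alpha> assume "\<alpha> \<in> ?A a"
      then have "\<alpha> $ j + \<alpha> $ l = k - a"
        using deg[of \<alpha>] by auto
      then show "form_fun (k - a) (\<lambda>w :: real ^ 2. (w $ 1) ^ (\<alpha> $ j) * (w $ 2) ^ (\<alpha> $ l))"
        using form_fun_mult[OF form_fun_power[OF form_fun_component[of "1::2"], of "\<alpha> $ j"]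
            form_fun_power[OF form_fun_component[of "2::2"], of "\<alpha> $ l"]] by simp
    qed
  next
    fix v
    have "F v = (\<Sum>a\<le>k. \<Sum>\<alpha>\<in>?A a. c \<alpha> * monomial_fun \<alpha> v)"
      unfolding A(3) by (rule sum.group[symmetric]) (use A(1) deg in force)+
    also have "\<dots> = (\<Sum>a\<le>k. (v $ i) ^ a * (\<Sum>\<alpha>\<in>?A a.
        c \<alpha> * (((vector [v $ j, v $ l] :: real ^ 2) $ 1) ^ (\<alpha> $ j) * (vector [v $ j, v $ l] :: real ^ 2) $ 2 ^ (\<alpha> $ l))))"
      by (simp add: mon sum_distrib_left mult_ac)
    finally show "F v = \<dots>" .
  qed
qed

text \<open>Divided by \<open>s\<close>, the polynomial is nonnegative for \<open>s > 0\<close> and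
  nonpositive for \<open>s < 0\<close>, and it tends to \<open>a\<close> at 0.\<close>

lemma polynomial_nonneg_linear_coeff:
  fixes a b c e :: real
  assumes "\<And>s. s * a + s\<^sup>2 * b + s ^ 3 * c + s ^ 4 * e \<ge> 0"
  shows "a = 0"
proof -
  define p where "p s = a + s * (b + s * (c + s * e))" for s
  have p: "s * p s \<ge> 0" for s
    using assms[of s] by (simp add: p_def algebra_simps power2_eq_square power3_eq_cube power4_eq_xxxx)
  have lim: "(p \<longlongrightarrow> a) (at 0 within S)" for S
    unfolding p_def by (auto intro!: tendsto_eq_intros)
  have pos: "p s \<ge> 0" if "s > 0" for s
    using p[of s] that by (simp add: zero_le_mult_iff)
  have neg: "p s \<le> 0" if "s < 0" for s
    using p[of s] that by (simp add: zero_le_mult_iff)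
  have "a \<ge> 0"
    by (rule tendsto_lowerbound[OF lim[of "{0<..}"]])
      (auto simp: eventually_at_filter pos intro!: always_eventually)
  moreover have "a \<le> 0"
    by (rule tendsto_upperbound[OF lim[of "{..<0}"]])
      (auto simp: eventually_at_filter neg intro!: always_eventually)
  ultimately show ?thesis by simp
qed

lemma ternary_quartic_sos:
  fixes F :: "real ^ 'n::finite \<Rightarrow> real"
  assumes "CARD('n) = 3" "form_fun 4 F" "\<And>v. F v \<ge> 0"
  shows "sos_fun 2 F"
proof -
  obtain i j l :: 'n where ijl: "UNIV = {i, j, l}" "i \<noteq> j" "i \<noteq> l" "j \<noteq> l"
    using assms(1) by (metis card_3_iff)
  have n4: "form_fun 4 (\<lambda>v :: real ^ 'n. (v \<bullet> v)\<^sup>2)"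
    using form_fun_norm_power[of 2] by simp
  obtain u where u: "norm u = 1" "\<And>v. F v - F u / (u \<bullet> u)\<^sup>2 * (v \<bullet> v)\<^sup>2 \<ge> 0"
    using form_fun_min[OF assms(2) n4] by auto
  have "u \<bullet> u = 1"
    using u(1) by (simp add: norm_eq_1)
  define F' where "F' v = F v - F u * (v \<bullet> v)\<^sup>2" for v
  have F': "form_fun 4 F'" "\<And>v. F' v \<ge> 0" "F' u = 0"
    unfolding F'_def using form_fun_diff[OF assms(2) form_fun_cmult[OF n4]] u(2) \<open>u \<bullet> u = 1\<close> by simp_all
  obtain A B :: "real ^ 'n \<Rightarrow> real ^ 'n" where A: "linear A" "linear B" "A (axis i 1) = u" "\<And>v. A (B v) = v"
    using rotate_axis[OF u(1), of i] by blast
  define T where "T v = F' (A v)" for v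
  have T: "form_fun 4 T"
    unfolding T_def by (rule form_fun_linear_compose[OF F'(1) A(1)])
  define W :: "real ^ 'n \<Rightarrow> real ^ 2" where "W v = vector [v $ j, v $ l]" for v
  have W: "linear W"
    by (auto intro!: linearI simp: W_def vec_eq_iff forall_2)
  obtain G :: "nat \<Rightarrow> real ^ 2 \<Rightarrow> real" where G: "\<And>a. a \<le> 4 \<Longrightarrow> form_fun (4 - a) (G a)"
    and TG: "\<And>v. T v = (\<Sum>a\<le>4. (v $ i) ^ a * G a (W v))"
    using form_fun_expand_ternary[OF T ijl] unfolding W_def by blast
  have TG: "T v = G 0 (W v) + v $ i * G 1 (W v) + (v $ i)\<^sup>2 * G 2 (W v) + (v $ i) ^ 3 * G 3 (W v) + (v $ i) ^ 4 * G 4 (W v)" for v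
    by (simp add: TG eval_nat_numeral)
  have psd: "G 0 w + x * G 1 w + x\<^sup>2 * G 2 w + x ^ 3 * G 3 w + x ^ 4 * G 4 w \<ge> 0" for x w
  proof -
    define v :: "real ^ 'n" where "v = (\<chi> m. if m = i then x else if m = j then w $ 1 else w $ 2)"
    have "v $ i = x" "W v = w"
      using ijl by (auto simp: v_def W_def vec_eq_iff forall_2)
    then show ?thesis
      using TG[of v] F'(2)[of "A v"] by (simp add: T_def)
  qed
  \<comment> \<open>The coefficient of the fourth power is the value of \<open>T\<close> on axis
    \<open>i\<close>, that is \<open>F' u = 0\<close>.\<close>
  have G4: "G 4 w = 0" for w
  proof -
    have "W (axis i 1) = 0"
      using ijl by (auto simp: W_def vec_eq_iff forall_2 axis_def)
    then have "G 4 0 = 0"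
      using TG[of "axis i 1"] F'(3) form_fun_at_0[OF G] by (simp add: T_def A(3))
    then show ?thesis
      using form_fun_degree_0[of "G 4" w] G[of 4] by simp
  qed
  \<comment> \<open>With \<open>x = 1\<close> and \<open>w\<close> scaled by \<open>s\<close>,
    homogeneity turns \<open>psd\<close> into a polynomial in \<open>s\<close> with linear
    coefficient \<open>G 3 w\<close>.\<close>
  have G3: "G 3 w = 0" for w
  proof (rule polynomial_nonneg_linear_coeff)
    fix s
    show "s * G 3 w + s\<^sup>2 * G 2 w + s ^ 3 * G 1 w + s ^ 4 * G 0 w \<ge> 0"
      using psd[of "s *\<^sub>R w" 1] form_fun_scaleR[OF G, of 3 s w] form_fun_scaleR[OF G, of 2 s w]
        form_fun_scaleR[OF G, of 1 s w] form_fun_scaleR[OF G, of 0 s w] G4[of "s *\<^sub>R w"]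
      by (simp add: add_ac)
  qed
  have g: "form_fun 3 (\<lambda>w. 1 / 2 * G 1 w)"
    using form_fun_cmult[OF G[of 1], of "1 / 2"] by simp
  have "sos_fun 2 (\<lambda>v. (v $ i)\<^sup>2 * G 2 (W v) + 2 * v $ i * (1 / 2 * G 1 (W v)) + G 0 (W v))"
    by (rule quartic_with_zero_sos[OF _ g _ _ form_fun_component W])
      (use G[of 2] G[of 0] psd in \<open>simp_all add: G3 G4 add_ac\<close>)
  then have "sos_fun 2 T"
    by (rule sos_fun_cong) (simp add: TG G3 G4)
  from sos_fun_linear_compose[OF this A(2)] have "sos_fun 2 F'"
    by (simp add: T_def A(4))
  then have "sos_fun 2 (\<lambda>v. F' v + F u * (v \<bullet> v)\<^sup>2)"
    using assms(3) by (intro sos_fun_add sos_fun_cmult sos_fun_norm_power)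
  then show ?thesis
    by (rule sos_fun_cong) (simp add: F'_def)
qed


subsection \<open>The Hilbert cases\<close>

lemma binary_sos_CARD_2:
  fixes F :: "real ^ 'n::finite \<Rightarrow> real"
  assumes "CARD('n) = 2" "form_fun (2 * d) F" "\<And>v. F v \<ge> 0"
  shows "sos_fun d F"
proof -
  obtain i j :: 'n where ij: "UNIV = {i, j}" "i \<noteq> j"
    using assms(1) by (metis card_2_iff)
  define L :: "real ^ 2 \<Rightarrow> real ^ 'n" where "L w = (\<chi> m. if m = i then w $ 1 else w $ 2)" for w
  define M :: "real ^ 'n \<Rightarrow> real ^ 2" where "M v = vector [v $ i, v $ j]" for v
  have L: "linear L"
    by (auto intro!: linearI simp: L_def vec_eq_iff)
  have M: "linear M"
    by (auto intro!: linearI simp: M_def vec_eq_iff forall_2)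
  have LM: "L (M v) = v" for v
    using ij by (auto simp: L_def M_def vec_eq_iff)
  have "sos_fun d (\<lambda>w. F (L w))"
    by (intro binary_sos form_fun_linear_compose[OF assms(2) L] assms(3))
  from sos_fun_linear_compose[OF this M] show ?thesis
    by (simp add: LM)
qed

lemma hilbert_case_sos:
  fixes f :: "'n::finite rpoly"
  assumes "hilbert_case CARD('n) (2 * d)" "f \<in> psd_forms d"
  shows "f \<in> sos_forms d"
proof -
  have f: "form_fun (2 * d) (poly_eval f)" "\<And>v. poly_eval f v \<ge> 0"
    using assms(2) by (auto simp: psd_forms_def intro: form_fun_poly_eval)
  consider "CARD('n) = 2" | "d = 1" | "CARD('n) = 3" "d = 2"
    using assms(1) by (auto simp: hilbert_case_def)
  then have "sos_fun d (poly_eval f)"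
  proof cases
    case 1
    then show ?thesis using f by (intro binary_sos_CARD_2)
  next
    case 2
    then show ?thesis using f quadratic_sos[of "poly_eval f"] by simp
  next
    case 3
    then show ?thesis using f by (auto intro: ternary_quartic_sos)
  qed
  then obtain g where "g \<in> sos_forms d" "poly_eval f = poly_eval g"
    using sos_fun_form_sos by blast
  then show ?thesis
    using poly_eval_inject[of f g] by metis
qed


subsection \<open>Vanishing of circuits\<close>

lemma sos_forms_psd: "f \<in> sos_forms d \<Longrightarrow> f \<in> psd_forms d"
  unfolding sos_forms_def psd_forms_def
  by (auto intro!: forms_sum forms_power2 sum_nonneg simp: poly_eval_sum)

lemma sonc_forms_psd: "f \<in> sonc_forms d \<Longrightarrow> f \<in> psd_forms d"
  unfolding sonc_forms_def nonneg_circuits_def psd_forms_def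
  by (auto intro!: forms_sum sum_nonneg simp: poly_eval_sum)

lemma sos_plus_sonc_forms_psd: "sos_plus_sonc_forms d \<subseteq> psd_forms d"
proof -
  have "g + h \<in> psd_forms d" if "g \<in> psd_forms d" "h \<in> psd_forms d" for g h :: "'n::finite rpoly"
    using that by (auto simp: psd_forms_def intro: forms_add)
  then show ?thesis
    by (auto simp: sos_plus_sonc_forms_def dest: sos_forms_psd sonc_forms_psd)
qed

lemma sos_forms_subset: "sos_forms d \<subseteq> sos_plus_sonc_forms d"
proof
  fix f :: "'n::finite rpoly"
  assume f: "f \<in> sos_forms d"
  have "0 \<in> sonc_forms d"
    unfolding sonc_forms_def by (auto intro!: exI[of _ 0])
  with f have "f + 0 \<in> sos_plus_sonc_forms d"
    unfolding sos_plus_sonc_forms_def by blast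
  then show "f \<in> sos_plus_sonc_forms d" by simp
qed

text \<open>
  By the inequality of arithmetic and geometric means, a circuit that vanishes at two positive points
  is nonpositive at their componentwise geometric mean, and strictly negative unless all of its
  monomials grow by the same factor from one point to the other.
\<close>

lemma nonneg_circuit_eq_0:
  fixes h :: "'n::finite rpoly"
  assumes "h \<in> nonneg_circuits d" "poly_eval h 1 = 0" "poly_eval h prime_point = 0"
  shows "h = 0"
proof (rule ccontr)
  assume "h \<noteq> 0"
  define S where "S = square_exponents h"
  let ?c = "Poly_Mapping.lookup h"
  have S: "finite S" "\<And>\<alpha>. \<alpha> \<in> S \<Longrightarrow> ?c \<alpha> > 0" "S \<subseteq> Poly_Mapping.keys h"
    by (auto simp: S_def square_exponents_def)
  from assms(1) consider "inner_exponents h = {}" | \<beta> where "inner_exponents h = {\<beta>}"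
    by (auto simp: nonneg_circuits_def circuits_def)
  then show False
  proof cases
    case 1
    then have "S = Poly_Mapping.keys h"
      using S(3) by (auto simp: inner_exponents_def S_def)
    then have "poly_eval h 1 > 0"
      unfolding poly_eval_one using S \<open>h \<noteq> 0\<close> by (intro sum_pos) auto
    then show False using assms(2) by simp
  next
    case (2 \<beta>)
    then have K: "Poly_Mapping.keys h = insert \<beta> S" "\<beta> \<notin> S"
      using S(3) by (auto simp: inner_exponents_def S_def)
    \<comment> \<open>The value of the monomial at the componentwise geometric mean of
      \<open>1\<close> and \<open>prime_point\<close>, as \<open>y_mean\<close> confirms.\<close>
    define y where "y \<alpha> = sqrt (monomial_fun \<alpha> (prime_point :: real ^ 'n))" for \<alpha>
    have y: "y \<alpha> > 0" "(y \<alpha>)\<^sup>2 = monomial_fun \<alpha> prime_point" for \<alpha>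
      using monomial_fun_prime_point_pos[of \<alpha>] by (simp_all add: y_def)
    have y_mean: "monomial_fun \<alpha> (\<chi> i. sqrt (prime_point $ i)) = y \<alpha>" for \<alpha> :: "nat ^ 'n"
    proof -
      have pow: "(sqrt x ^ k)\<^sup>2 = x ^ k" if "x \<ge> 0" for x :: real and k :: nat
        using that by (metis power_mult mult.commute real_sqrt_pow2)
      have "(monomial_fun \<alpha> (\<chi> i. sqrt (prime_point $ i :: real)))\<^sup>2 = (y \<alpha>)\<^sup>2"
        unfolding y(2) monomial_fun_def prod_power_distrib
        by (intro prod.cong refl) (simp add: pow less_imp_le[OF prime_point_pos])
      moreover have "monomial_fun \<alpha> (\<chi> i. sqrt (prime_point $ i :: real)) \<ge> 0"
        unfolding monomial_fun_def by (intro prod_nonneg) (simp add: less_imp_le[OF prime_point_pos])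
      ultimately show ?thesis
        using y(1)[of \<alpha>] by (simp add: power2_eq_iff_nonneg)
    qed
    have 1: "(\<Sum>\<alpha>\<in>S. ?c \<alpha>) = - ?c \<beta>"
      using assms(2) K S(1) by (simp add: poly_eval_one)
    have 2: "(\<Sum>\<alpha>\<in>S. ?c \<alpha> * (y \<alpha>)\<^sup>2) = - ?c \<beta> * (y \<beta>)\<^sup>2"
      using assms(3) K S(1) by (simp add: poly_eval_eq y(2))
    have "poly_eval h (\<chi> i. sqrt (prime_point $ i)) \<ge> 0"
      using assms(1) by (simp add: nonneg_circuits_def psd_forms_def)
    then have 3: "(\<Sum>\<alpha>\<in>S. ?c \<alpha> * y \<alpha>) + ?c \<beta> * y \<beta> \<ge> 0"
      using K S(1) by (simp add: poly_eval_eq y_mean)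
    \<comment> \<open>By the two zeros, this weighted sum of squares is
      \<open>- 2 * y \<beta>\<close> times the value of \<open>h\<close> at the geometric mean,
      hence nonpositive.\<close>
    have "(\<Sum>\<alpha>\<in>S. ?c \<alpha> * (y \<alpha> - y \<beta>)\<^sup>2)
      = (\<Sum>\<alpha>\<in>S. ?c \<alpha> * (y \<alpha>)\<^sup>2) + (y \<beta>)\<^sup>2 * (\<Sum>\<alpha>\<in>S. ?c \<alpha>) - 2 * y \<beta> * (\<Sum>\<alpha>\<in>S. ?c \<alpha> * y \<alpha>)"
      unfolding sum_distrib_left sum.distrib[symmetric] sum_subtractf[symmetric]
      by (intro sum.cong refl) (simp add: power2_eq_square algebra_simps)
    also have "\<dots> = - (2 * y \<beta> * ((\<Sum>\<alpha>\<in>S. ?c \<alpha> * y \<alpha>) + ?c \<beta> * y \<beta>))"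
      unfolding 1 2 by (simp add: power2_eq_square algebra_simps)
    also have "\<dots> \<le> 0"
      using 3 y(1)[of \<beta>] by simp
    finally have "(\<Sum>\<alpha>\<in>S. ?c \<alpha> * (y \<alpha> - y \<beta>)\<^sup>2) \<le> 0" .
    moreover have nn: "?c \<alpha> * (y \<alpha> - y \<beta>)\<^sup>2 \<ge> 0" if "\<alpha> \<in> S" for \<alpha>
      using S(2)[OF that] by simp
    then have "(\<Sum>\<alpha>\<in>S. ?c \<alpha> * (y \<alpha> - y \<beta>)\<^sup>2) \<ge> 0"
      by (rule sum_nonneg)
    ultimately have "(\<Sum>\<alpha>\<in>S. ?c \<alpha> * (y \<alpha> - y \<beta>)\<^sup>2) = 0"
      by simp
    then have "?c \<alpha> * (y \<alpha> - y \<beta>)\<^sup>2 = 0" if "\<alpha> \<in> S" for \<alpha>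
      using sum_nonneg_eq_0_iff[of S "\<lambda>\<alpha>. ?c \<alpha> * (y \<alpha> - y \<beta>)\<^sup>2"] S(1) nn that by blast
    then have "y \<alpha> = y \<beta>" if "\<alpha> \<in> S" for \<alpha>
      using S(2)[OF that] that by fastforce
    then have "\<alpha> = \<beta>" if "\<alpha> \<in> S" for \<alpha>
      using that by (intro monomial_fun_prime_point_inj) (simp flip: y(2))
    then have "S = {}"
      using K(2) by blast
    then have "?c \<beta> = 0"
      using 1 by simp
    then show False
      using K(1) by (metis in_keys_iff insertI1)
  qed
qed

text \<open>In a decomposition of \<open>F\<close> every nonnegative summand vanishes at the zeros
  of \<open>F\<close>. So each circuit is zero by \<open>nonneg_circuit_eq_0\<close>, and
  \<open>F\<close> itself would be a sum of squares.\<close>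

lemma sos_plus_sonc_neq_psd:
  fixes F :: "real ^ 'n::finite \<Rightarrow> real"
  assumes F: "form_fun (2 * d) F" "\<And>v. F v \<ge> 0" "F 1 = 0" "F prime_point = 0"
    and not_sos: "\<And>(m :: nat) G. (\<And>s. s < m \<Longrightarrow> form_fun d (G s)) \<Longrightarrow>
      (\<And>v. F v = (\<Sum>s<m. (G s v)\<^sup>2)) \<Longrightarrow> False"
  shows "(sos_plus_sonc_forms d :: 'n rpoly set) \<noteq> psd_forms d"
proof
  assume eq: "(sos_plus_sonc_forms d :: 'n rpoly set) = psd_forms d"
  obtain f where f: "f \<in> forms (2 * d)" "F = poly_eval f"
    using F(1) by (auto simp: form_fun_def)
  have "f \<in> psd_forms d"
    using f F(2) by (simp add: psd_forms_def)
  then have "f \<in> sos_plus_sonc_forms d"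
    using eq by simp
  then obtain g h where gh: "f = g + h" "g \<in> sos_forms d" "h \<in> sonc_forms d"
    by (auto simp: sos_plus_sonc_forms_def)
  obtain m :: nat and c where c: "\<And>i. i < m \<Longrightarrow> c i \<in> nonneg_circuits d" "h = (\<Sum>i<m. c i)"
    using gh(3) by (auto simp: sonc_forms_def)
  have c_nonneg: "poly_eval (c i) v \<ge> 0" if "i < m" for i v
    using c(1)[OF that] by (simp add: nonneg_circuits_def psd_forms_def)
  have "poly_eval (c i) v = 0" if "i < m" "F v = 0" for i v
  proof -
    have "poly_eval g v \<ge> 0"
      using sos_forms_psd[OF gh(2)] by (simp add: psd_forms_def)
    moreover have "poly_eval g v + (\<Sum>i<m. poly_eval (c i) v) = 0"
      using that(2) by (simp add: f(2) gh(1) c(2) poly_eval_sum)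
    moreover have "(\<Sum>i<m. poly_eval (c i) v) \<ge> 0"
      by (intro sum_nonneg) (simp add: c_nonneg)
    ultimately have "(\<Sum>i<m. poly_eval (c i) v) = 0"
      by linarith
    then show ?thesis
      using sum_nonneg_eq_0_iff[of "{..<m}" "\<lambda>i. poly_eval (c i) v"] that(1) c_nonneg by auto
  qed
  then have "c i = 0" if "i < m" for i
    using that c(1) F(3,4) by (intro nonneg_circuit_eq_0) auto
  then have "f = g"
    using gh(1) c(2) by simp
  then obtain k :: nat and q where q: "\<And>s. s < k \<Longrightarrow> q s \<in> forms d" "f = (\<Sum>s<k. (q s)\<^sup>2)"
    using gh(2) by (auto simp: sos_forms_def)
  show False
  proof (rule not_sos)
    show "form_fun d (poly_eval (q s))" if "s < k" for s
      using q(1)[OF that] by (rule form_fun_poly_eval)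
    show "F v = (\<Sum>s<k. (poly_eval (q s) v)\<^sup>2)" for v
      by (simp add: f(2) q(2) poly_eval_sum)
  qed
qed


subsection \<open>The other cases\<close>

text \<open>By symmetry \<open>a \<ge> b \<ge> c\<close>, and then the expression is
  \<open>(a - b)^2 (a + b - c) + c (a - c) (b - c)\<close>.\<close>

lemma schur_inequality:
  fixes a b c :: real
  assumes "a \<ge> 0" "b \<ge> 0" "c \<ge> 0"
  shows "a * (a - b) * (a - c) + b * (b - a) * (b - c) + c * (c - a) * (c - b) \<ge> 0"
proof -
  have *: "x * (x - y) * (x - z) + y * (y - x) * (y - z) + z * (z - x) * (z - y) \<ge> 0"
    if "x \<ge> y" "y \<ge> z" "z \<ge> 0" for x y z :: real
  proof -
    have "x * (x - y) * (x - z) + y * (y - x) * (y - z) + z * (z - x) * (z - y)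
      = (x - y)\<^sup>2 * (x + y - z) + z * ((x - z) * (y - z))"
      by (simp add: power2_eq_square algebra_simps)
    also have "\<dots> \<ge> 0"
      using that by (intro add_nonneg_nonneg mult_nonneg_nonneg) auto
    finally show ?thesis .
  qed
  consider "a \<ge> b" "b \<ge> c" | "a \<ge> c" "c \<ge> b" | "b \<ge> a" "a \<ge> c" | "b \<ge> c" "c \<ge> a"
    | "c \<ge> a" "a \<ge> b" | "c \<ge> b" "b \<ge> a"
    by linarith
  then show ?thesis
    by cases (use assms *[of a b c] *[of a c b] *[of b a c] *[of b c a] *[of c a b] *[of c b a] in
      \<open>simp_all add: mult_ac add_ac\<close>)
qed

text \<open>Robinson's sextic as Schur's expression in three squares. For \<open>z = 1\<close> and
  \<open>x\<close>, \<open>y\<close> in {-1, 0, 1} it vanishes except at the centre of the grid,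
  where it is 1.\<close>

definition robinson :: "real \<Rightarrow> real \<Rightarrow> real \<Rightarrow> real" where
  "robinson x y z = x\<^sup>2 * (x\<^sup>2 - y\<^sup>2) * (x\<^sup>2 - z\<^sup>2) + y\<^sup>2 * (y\<^sup>2 - x\<^sup>2) * (y\<^sup>2 - z\<^sup>2)
    + z\<^sup>2 * (z\<^sup>2 - x\<^sup>2) * (z\<^sup>2 - y\<^sup>2)"

lemma robinson_nonneg: "robinson x y z \<ge> 0"
  unfolding robinson_def by (rule schur_inequality) auto

lemma form_fun_robinson:
  assumes "form_fun 1 X" "form_fun 1 Y" "form_fun 1 Z"
  shows "form_fun 6 (\<lambda>v. robinson (X v) (Y v) (Z v))"
proof -
  note sq = assms[THEN form_fun_power2]
  have "form_fun (2 * 1 + 2 * 1 + 2 * 1) (\<lambda>v. robinson (X v) (Y v) (Z v))"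
    unfolding robinson_def by (intro form_fun_add form_fun_mult form_fun_diff sq)
  then show ?thesis by simp
qed

text \<open>Grouped into products of two quadratic factors so that degrees can be counted by pairs
  of linear forms.\<close>

definition choi_lam :: "real \<Rightarrow> real \<Rightarrow> real \<Rightarrow> real \<Rightarrow> real" where
  "choi_lam w x y z = (w\<^sup>2)\<^sup>2 + (x * y)\<^sup>2 + (y * z)\<^sup>2 + (z * x)\<^sup>2 - 4 * ((w * x) * (y * z))"

text \<open>The inequality of arithmetic and geometric means for the four square terms, made
  explicit by an identity in absolute values.\<close>

lemma choi_lam_nonneg: "choi_lam w x y z \<ge> 0"
proof -
  have "choi_lam w x y z = (w\<^sup>2 - \<bar>x * y\<bar>)\<^sup>2 + z\<^sup>2 * (\<bar>x\<bar> - \<bar>y\<bar>)\<^sup>2 + 2 * \<bar>x * y\<bar> * (\<bar>w\<bar> - \<bar>z\<bar>)\<^sup>2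
      + 4 * (\<bar>w * x * y * z\<bar> - w * x * y * z)"
    by (simp add: choi_lam_def power2_eq_square abs_mult algebra_simps)
  then show ?thesis by simp
qed

lemma form_fun_choi_lam:
  assumes "form_fun 1 W" "form_fun 1 X" "form_fun 1 Y" "form_fun 1 Z"
  shows "form_fun 4 (\<lambda>v. choi_lam (W v) (X v) (Y v) (Z v))"
proof -
  have m: "form_fun 2 (\<lambda>v. F v * G v)" if "form_fun 1 F" "form_fun 1 G" for F G :: "real ^ 'a \<Rightarrow> real"
    using form_fun_mult[OF that] unfolding one_add_one .
  have q: "form_fun 4 (\<lambda>v. (F v)\<^sup>2)" if "form_fun 2 F" for F :: "real ^ 'a \<Rightarrow> real"
    using form_fun_power2[OF that] by simp
  have "form_fun 4 (\<lambda>v. (W v * X v) * (Y v * Z v))"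
    using form_fun_mult[OF m m] assms by fastforce
  moreover have "form_fun 2 (\<lambda>v. (W v)\<^sup>2)"
    using form_fun_power2[OF assms(1)] by simp
  ultimately show ?thesis
    unfolding choi_lam_def by (intro form_fun_add form_fun_diff form_fun_cmult q m assms)
qed

text \<open>Linear coordinates that send \<open>1\<close> to \<open>1\<close> and the prime point to a multiple of the axis \<open>k\<close>.\<close>

definition ratio_coord :: "'n \<Rightarrow> 'n \<Rightarrow> real ^ 'n::finite \<Rightarrow> real" where
  "ratio_coord k i v = (prime_point $ k * v $ i - prime_point $ i * v $ k) / (prime_point $ k - prime_point $ i)"

text \<open>Solves \<open>ratio_coord k i v = r $ i\<close> for \<open>v $ i\<close>, given
  \<open>v $ k = r $ k\<close>. For \<open>i = k\<close> the quotient in \<open>ratio_coord\<close>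
  is 0/0 = 0, so \<open>v $ k\<close> itself serves as that coordinate.\<close>

definition ratio_lift :: "'n \<Rightarrow> real ^ 'n \<Rightarrow> real ^ 'n::finite" where
  "ratio_lift k r = (\<chi> i. (r $ i * (prime_point $ k - prime_point $ i) + prime_point $ i * r $ k) / prime_point $ k)"

lemma form_fun_ratio_coord: "form_fun 1 (ratio_coord k i)"
proof -
  have "form_fun 1 (\<lambda>v :: real ^ 'a. 1 / (prime_point $ k - prime_point $ i) *
      (prime_point $ k * v $ i - prime_point $ i * v $ k))"
    by (intro form_fun_cmult form_fun_diff form_fun_component)
  then show ?thesis
    by (rule form_fun_cong) (simp_all add: ratio_coord_def)
qed

lemma ratio_coord_one: "i \<noteq> k \<Longrightarrow> ratio_coord k i 1 = 1"
  using prime_point_neq[of i k] by (simp add: ratio_coord_def)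

lemma ratio_coord_prime_point: "ratio_coord k i prime_point = 0"
  by (simp add: ratio_coord_def)

lemma linear_ratio_lift: "linear (ratio_lift k)"
  by (auto intro!: linearI simp: ratio_lift_def vec_eq_iff add_divide_distrib
      distrib_left distrib_right mult.assoc mult.left_commute[of "prime_point $ _"])

lemma ratio_lift_component: "ratio_lift k r $ k = r $ k"
  using prime_point_pos[of k] by (simp add: ratio_lift_def)

lemma ratio_coord_lift:
  assumes "i \<noteq> k"
  shows "ratio_coord k i (ratio_lift k r) = r $ i"
proof -
  have "prime_point $ k * ratio_lift k r $ i = r $ i * (prime_point $ k - prime_point $ i) + prime_point $ i * r $ k"
    using prime_point_pos[of k] by (simp add: ratio_lift_def)
  then show ?thesis
    using prime_point_neq[OF assms] by (simp add: ratio_coord_def ratio_lift_component)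
qed

section \<open>Forms outside the cone\<close>

lemma sos_zero:
  fixes G :: "nat \<Rightarrow> real"
  assumes "(\<Sum>s<m. (G s)\<^sup>2) = 0" "s < m"
  shows "G s = 0"
proof -
  have "(G s)\<^sup>2 = 0"
    using assms sum_nonneg_eq_0_iff[of "{..<m}" "\<lambda>s. (G s)\<^sup>2"] by auto
  then show ?thesis by simp
qed

text \<open>The arguments of \<open>robinson\<close> are \<open>(0, 1, 1)\<close> at
  \<open>1\<close> and a multiple of \<open>(1, 0, 1)\<close> at the prime point, both zeros. In a
  sum of squares each root is a power of \<open>v $ k\<close> times a cubic; the cubics vanish at
  eight points of a grid, hence at the ninth, where the sextic is 1.\<close>

lemma sextic_not_sos_plus_sonc:
  assumes "CARD('n::finite) \<ge> 3" "d \<ge> 3"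
  shows "(sos_plus_sonc_forms d :: 'n rpoly set) \<noteq> psd_forms d"
proof -
  obtain S :: "'n set" where "card S = 3"
    using obtain_subset_with_card_n[OF assms(1)] by blast
  then obtain i j k :: 'n where ijk: "i \<noteq> j" "i \<noteq> k" "j \<noteq> k"
    by (metis card_3_iff)
  define R where "R v = robinson (v $ k - ratio_coord k i v) (ratio_coord k j v) (v $ k)" for v
  have R: "form_fun 6 R"
    unfolding R_def by (intro form_fun_robinson form_fun_diff form_fun_component form_fun_ratio_coord)
  define F where "F v = (v $ k) ^ (2 * (d - 3)) * R v" for v
  have "form_fun (2 * (d - 3) * 1 + 6) F"
    unfolding F_def[abs_def] by (intro form_fun_mult form_fun_power form_fun_component R)
  then have "form_fun (2 * d) F"
    using assms(2) by (simp add: diff_mult_distrib2)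
  then show ?thesis
  proof (rule sos_plus_sonc_neq_psd)
    show "F v \<ge> 0" for v
      unfolding F_def R_def by (intro mult_nonneg_nonneg robinson_nonneg) (simp add: power_mult)
    show "F 1 = 0"
      using ijk by (simp add: F_def R_def ratio_coord_one robinson_def)
    show "F prime_point = 0"
      by (simp add: F_def R_def ratio_coord_prime_point robinson_def)
  next
    fix m :: nat and G
    assume G: "\<And>s. s < m \<Longrightarrow> form_fun d (G s)" and FG: "\<And>v. F v = (\<Sum>s<m. (G s v)\<^sup>2)"
    \<comment> \<open>Each single square is at most \<open>F\<close>, which carries an even power of
      \<open>v $ k\<close>.\<close>
    have "\<exists>H. form_fun 3 H \<and> (\<forall>v. G s v = (v $ k) ^ (d - 3) * H v)" if "s < m" for s
    proof (rule form_fun_power_factor)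
      show "form_fun (3 + (d - 3)) (G s)"
        using G[OF that] assms(2) by simp
      show "(G s v)\<^sup>2 \<le> (v $ k) ^ (2 * (d - 3)) * R v" for v
        unfolding F_def[symmetric] FG by (rule member_le_sum) (use that in auto)
    qed (rule form_fun_continuous[OF R])
    then obtain H where H: "\<And>s. s < m \<Longrightarrow> form_fun 3 (H s)"
      "\<And>s v. s < m \<Longrightarrow> G s v = (v $ k) ^ (d - 3) * H s v"
      by metis
    define P where "P s r = H s (ratio_lift k r)" for s r
    have P: "form_fun 3 (P s)" if "s < m" for s
      unfolding P_def[abs_def] using H(1)[OF that] linear_ratio_lift by (rule form_fun_linear_compose)
    have sum_P: "(\<Sum>s<m. (P s r)\<^sup>2) = robinson (1 - r $ i) (r $ j) 1" if "r $ k = 1" for r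
    proof -
      have "(\<Sum>s<m. (P s r)\<^sup>2) = F (ratio_lift k r)"
        unfolding FG by (intro sum.cong refl) (simp add: H(2) P_def ratio_lift_component that)
      also have "\<dots> = robinson (1 - r $ i) (r $ j) 1"
        using ijk by (simp add: F_def R_def ratio_lift_component ratio_coord_lift that)
      finally show ?thesis .
    qed
    have P_zero: "P s r = 0" if "s < m" "r $ k = 1" "robinson (1 - r $ i) (r $ j) 1 = 0" for s r
      using sos_zero[of "\<lambda>s. P s r"] sum_P[OF that(2)] that(1,3) by simp
    \<comment> \<open>For \<open>r $ k = 1\<close> the sextic is taken at
      \<open>(1 - r $ i, r $ j, 1)\<close>, so \<open>?w\<close> is the centre of the grid and the
      steps \<open>?u\<close>, \<open>?v\<close> reach the other eight points.\<close>
    let ?w = "axis k 1 + axis i 1 :: real ^ 'n" and ?u = "axis i 1 :: real ^ 'n" and ?v = "axis j 1 :: real ^ 'n"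
    have "P s ?w = 0" if "s < m" for s
      using form_fun_nine_points[OF P[OF that], of ?w ?u ?v] ijk
      by (simp add: P_zero that axis_def robinson_def)
    then have "(\<Sum>s<m. (P s ?w)\<^sup>2) = 0"
      by simp
    moreover have "(\<Sum>s<m. (P s ?w)\<^sup>2) = 1"
      using ijk by (subst sum_P) (auto simp: axis_def robinson_def)
    ultimately show False by simp
  qed
qed

text \<open>The same plan with quadrics: the arguments of \<open>choi_lam\<close> are
  \<open>(1, 1, 1, 1)\<close> at \<open>1\<close> and a multiple of the third unit vector at the
  prime point, both zeros.\<close>

lemma quartic_not_sos_plus_sonc:
  assumes "CARD('n::finite) \<ge> 4"
  shows "(sos_plus_sonc_forms 2 :: 'n rpoly set) \<noteq> psd_forms 2"
proof -
  obtain S :: "'n set" where "card S = 4"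
    using obtain_subset_with_card_n[OF assms] by blast
  then obtain k T where "S = insert k T" "k \<notin> T" "card T = 3"
    using card_Suc_eq[of S 3] by auto
  then obtain i j l where ijl: "i \<noteq> j" "i \<noteq> l" "j \<noteq> l" "i \<noteq> k" "j \<noteq> k" "l \<noteq> k"
    by (auto simp: card_3_iff)
  define F where "F v = choi_lam (ratio_coord k i v) (ratio_coord k j v) (v $ k) (ratio_coord k l v)" for v
  have "form_fun 4 F"
    unfolding F_def by (intro form_fun_choi_lam form_fun_component form_fun_ratio_coord)
  then have "form_fun (2 * 2) F" by simp
  then show ?thesis
  proof (rule sos_plus_sonc_neq_psd)
    show "F v \<ge> 0" for v
      unfolding F_def by (rule choi_lam_nonneg)
    show "F 1 = 0"
      using ijl by (simp add: F_def ratio_coord_one choi_lam_def)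
    show "F prime_point = 0"
      by (simp add: F_def ratio_coord_prime_point choi_lam_def)
  next
    fix m :: nat and G
    assume G: "\<And>s. s < m \<Longrightarrow> form_fun 2 (G s)" and FG: "\<And>v. F v = (\<Sum>s<m. (G s v)\<^sup>2)"
    define P where "P s r = G s (ratio_lift k r)" for s r
    have P: "form_fun 2 (P s)" if "s < m" for s
      unfolding P_def[abs_def] using G[OF that] linear_ratio_lift by (rule form_fun_linear_compose)
    have sum_P: "(\<Sum>s<m. (P s r)\<^sup>2) = choi_lam (r $ i) (r $ j) (r $ k) (r $ l)" for r
      using ijl FG[of "ratio_lift k r"] by (simp add: P_def F_def ratio_lift_component ratio_coord_lift)
    have P_zero: "P s r = 0" if "s < m" "choi_lam (r $ i) (r $ j) (r $ k) (r $ l) = 0" for s r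
      using sos_zero[of "\<lambda>s. P s r"] sum_P[of r] that by simp
    let ?W = "axis i 1 :: real ^ 'n" and ?X = "axis j 1 :: real ^ 'n"
      and ?Y = "axis k 1 :: real ^ 'n" and ?Z = "axis l 1 :: real ^ 'n"
    have "P s ?W = 0" if "s < m" for s
    proof -
      note par = form_fun_parallelogram[OF P[OF that]]
      \<comment> \<open>The four sign vectors with first entry 1 and product 1 are zeros, as are
        three of the axes. Combining the four parallelogram identities expresses
        \<open>P s ?W\<close> by the values there.\<close>
      have "P s ((?W + ?X) + (?Y + ?Z)) = 0" "P s ((?W + ?X) - (?Y + ?Z)) = 0"
        "P s ((?W - ?X) + (?Y - ?Z)) = 0" "P s ((?W - ?X) - (?Y - ?Z)) = 0"
        "P s ?X = 0" "P s ?Y = 0" "P s ?Z = 0"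
        using ijl by (auto intro!: P_zero that simp: axis_def choi_lam_def)
      then show ?thesis
        using par[of "?W + ?X" "?Y + ?Z"] par[of "?W - ?X" "?Y - ?Z"] par[of ?W ?X] par[of ?Y ?Z] by linarith
    qed
    then have "(\<Sum>s<m. (P s ?W)\<^sup>2) = 0"
      by simp
    moreover have "(\<Sum>s<m. (P s ?W)\<^sup>2) = 1"
      using ijl by (subst sum_P) (auto simp: axis_def choi_lam_def)
    ultimately show False by simp
  qed
qed

theorem proposition5p2:
  fixes d :: nat
  assumes "d \<ge> 1"
    and "CARD('n::finite) \<ge> 2 \<or> d = 1"
  shows "(sos_plus_sonc_forms d :: 'n rpoly set) = psd_forms d
    \<longleftrightarrow> hilbert_case CARD('n) (2 * d)"
proof
  assume "hilbert_case CARD('n) (2 * d)"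
  then have "(psd_forms d :: 'n rpoly set) \<subseteq> sos_plus_sonc_forms d"
    using hilbert_case_sos sos_forms_subset by blast
  then show "(sos_plus_sonc_forms d :: 'n rpoly set) = psd_forms d"
    using sos_plus_sonc_forms_psd by blast
next
  assume eq: "(sos_plus_sonc_forms d :: 'n rpoly set) = psd_forms d"
  show "hilbert_case CARD('n) (2 * d)"
  proof (rule ccontr)
    assume "\<not> hilbert_case CARD('n) (2 * d)"
    \<comment> \<open>Here \<open>d > 1\<close>, so the second assumption gives at least two
      variables, and three since two are excluded; for \<open>d = 2\<close> three are excluded as
      well.\<close>
    then consider "CARD('n) \<ge> 3" "d \<ge> 3" | "CARD('n) \<ge> 4" "d = 2"
      using assms by (fastforce simp: hilbert_case_def)
    then show False
      using eq sextic_not_sos_plus_sonc[where 'n = 'n, of d] quartic_not_sos_plus_sonc[where 'n = 'n]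
      by cases auto
  qed
qed

end
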